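(* Let $\mathcal{A}$ be a Mackey-complete continuous inverse algebra over $\mathbb{C}$ endowed with a continuous involution $a\mapsto a^*$. Then $\mathcal{A}$ is hermitian if and only if the matrix algebra $M_2(\mathcal{A})$ has the property that, for every $n\ge 1$ and every $X\in\mathrm{Fl}_{M_2(\mathcal{A})}(n)$, the unitary group $\mathrm{U}_2(\mathcal{A})=\mathrm{U}(M_2(\mathcal{A}))$ acts transitively on the flag manifold $\mathrm{Fl}_{M_2(\mathcal{A})}(X)$.
   Context: A continuous inverse algebra (CIA) is a Hausdorff locally convex unital associative (complex) algebra $\mathcal{A}$ with (jointly) continuous multiplication whose group of units $\mathcal{A}^\times$ is open and for which the inversion $\mathcal{A}^\times\to\mathcal{A}$, $a\mapsto a^{-1}$, is continuous. A locally convex space is Mackey-complete if every Mackey-Cauchy sequence converges; equivalently, the Riemann integral over $[0,1]$ of every smooth curve exists in the space. An involution is a conjugate-linear, anti-multiplicative map $a\mapsto a^*$ with $a^{**}=a$. The spectrum is $\sigma_{\mathcal{A}}(a)=\{\lambda\in\mathbb{C}\mid \lambda\mathbf{1}-a\notin\mathcal{A}^\times\}$. An algebra with involution is hermitian if $\sigma_{\mathcal{A}}(a)\subseteq\mathbb{R}$ whenever $a=a^*$. $M_2(\mathcal{A})$ carries the product topology and the involution $((a_{ij})^* )_{ij}=a_{ji}^*$; it is again a CIA. For a unital algebra $\mathcal{C}$ with involution, $\mathrm{U}(\mathcal{C})=\{u\in\mathcal{C}^\times\mid u^*u=\mathbf{1}\}$. Flags. For a unital complex associative algebra $\mathcal{C}$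 let $\mathcal{P}(\mathcal{C})$ be the set of idempotents of $\mathcal{C}$ (not necessarily self-adjoint). For $p,q\in\mathcal{P}(\mathcal{C})$ write $p\le q$ if $qp=p$ (i.e. $p\mathcal{C}\subseteq q\mathcal{C}$), and $p\sim q$ if $pq=q$ and $qp=p$ (i.e. $p\mathcal{C}=q\mathcal{C}$). For $n\ge1$ let $\mathcal{P}_n(\mathcal{C})=\{(p_1,\dots,p_n)\in\mathcal{P}(\mathcal{C})^n\mid p_1\le\cdots\le p_n\}$, and let $\mathrm{Fl}_{\mathcal{C}}(n)=\mathcal{P}_n(\mathcal{C})/\sim$, where $(p_1,\dots,p_n)\sim(q_1,\dots,q_n)$ iff $p_j\sim q_j$ for all $j$. The class $[(p_1,\dots,p_n)]$ is identified with the tuple of right ideals $(p_1\mathcal{C},\dots,p_n\mathcal{C})$. The group $\mathcal{C}^\times$ acts on $\mathrm{Fl}_{\mathcal{C}}(n)$ by left multiplication, $g\cdot(p_1\mathcal{C},\dots,p_n\mathcal{C})=(gp_1\mathcal{C},\dots,gp_n\mathcal{C})$, i.e. $g\cdot[(p_j)_j]=[(gp_jg^{-1})_j]$. For $X\in\mathrm{Fl}_{\mathcal{C}}(n)$ the flag manifold $\mathrm{Fl}_{\mathcal{C}}(X)$ is the $\mathcal{C}^\times$-orbit of $X$; the unitary group $\mathrm{U}(\mathcal{C})\subseteq\mathcal{C}^\times$ acts on it by restriction. *)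

theory Defs
  imports "HOL-Analysis.Analysis"
begin

section \<open>Units\<close>

definition units :: "'c::monoid_mult set" where
  "units = {a. \<exists>b. a * b = 1 \<and> b * a = 1}"

definition unit_inv :: "'c::monoid_mult \<Rightarrow> 'c" where
  "unit_inv a = (THE b. a * b = 1 \<and> b * a = 1)"

lemma unit_inv_eqI:
  assumes "a * b = 1" "b * a = 1"
  shows "unit_inv a = b"
  unfolding unit_inv_def
proof (rule the_equality)
  show "c = b" if "a * c = 1 \<and> c * a = 1" for c
  proof -
    have "b * (a * c) = (b * a) * c"
      by (simp only: mult.assoc)
    then show ?thesis
      using that assms by simp
  qed
qed (use assms in simp)

lemma units_inv:
  assumes "a \<in> units"
  shows "a * unit_inv a = 1" "unit_inv a * a = 1"
  using assms unit_inv_eqI unfolding units_def by blast+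

section \<open>Continuous inverse algebras\<close>

(* The class combination {ring, monoid_mult} is used instead of ring_1 because the latter
   contains 1 \<noteq> 0 and would exclude the zero algebra. The real scalar multiplication of the
   class real_algebra carries no extra information: it is the restriction of scaleC. *)

locale continuous_inverse_algebra =
  fixes scaleC :: "complex \<Rightarrow> 'a \<Rightarrow>
    'a::{real_algebra, monoid_mult, t2_space, topological_ab_group_add, topological_semigroup_mult}"
  assumes vector_space_scaleC: "vector_space scaleC"
    and scaleC_of_real: "scaleC (of_real r) x = r *\<^sub>R x"
    and mult_scaleC_left: "scaleC c x * y = scaleC c (x * y)"
    and mult_scaleC_right: "x * scaleC c y = scaleC c (x * y)"
    and continuous_scaleC: "continuous_on UNIV (\<lambda>(c, x). scaleC c x)"
    and locally_convex:
      "open (U :: 'a set) \<Longrightarrow> 0 \<in> U \<Longrightarrow> \<exists>V. open V \<and> convex V \<and> 0 \<in> V \<and> V \<subseteq> U"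
    and open_units: "open (units :: 'a set)"
    and continuous_unit_inv: "continuous_on (units :: 'a set) unit_inv"

definition tvs_bounded :: "'a::{real_vector, topological_space} set \<Rightarrow> bool" where
  "tvs_bounded B \<longleftrightarrow> (\<forall>U. open U \<longrightarrow> 0 \<in> U \<longrightarrow> (\<exists>t>0. B \<subseteq> (*\<^sub>R) t ` U))"

definition mackey_Cauchy :: "(nat \<Rightarrow> 'a::{real_vector, topological_space}) \<Rightarrow> bool" where
  "mackey_Cauchy x \<longleftrightarrow>
    (\<exists>B \<mu>. tvs_bounded B \<and> (\<mu> \<longlongrightarrow> (0::real)) (sequentially \<times>\<^sub>F sequentially) \<and>
      (\<forall>m n. x m - x n \<in> (*\<^sub>R) (\<mu> (m, n)) ` B))"

definition mackey_complete :: "'a::{real_vector, topological_space} itself \<Rightarrow> bool" where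
  "mackey_complete _ \<longleftrightarrow> (\<forall>x :: nat \<Rightarrow> 'a. mackey_Cauchy x \<longrightarrow> convergent x)"

section \<open>Involutions, spectrum, hermitian algebras\<close>

definition algebra_involution :: "(complex \<Rightarrow> 'a \<Rightarrow> 'a) \<Rightarrow> ('a \<Rightarrow> 'a::ring) \<Rightarrow> bool" where
  "algebra_involution scaleC star \<longleftrightarrow>
    (\<forall>a b. star (a + b) = star a + star b) \<and>
    (\<forall>c a. star (scaleC c a) = scaleC (cnj c) (star a)) \<and>
    (\<forall>a b. star (a * b) = star b * star a) \<and>
    (\<forall>a. star (star a) = a)"

definition spectrum ::
    "(complex \<Rightarrow> 'a \<Rightarrow> 'a) \<Rightarrow> 'a::{ring, monoid_mult} \<Rightarrow> complex set" where
  "spectrum scaleC a = {z. scaleC z 1 - a \<notin> units}"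

definition hermitian ::
    "(complex \<Rightarrow> 'a \<Rightarrow> 'a) \<Rightarrow> ('a \<Rightarrow> 'a::{ring, monoid_mult}) \<Rightarrow> bool" where
  "hermitian scaleC star \<longleftrightarrow> (\<forall>a. a = star a \<longrightarrow> spectrum scaleC a \<subseteq> \<real>)"

definition unitary_group :: "('c \<Rightarrow> 'c) \<Rightarrow> 'c::monoid_mult set" where
  "unitary_group star = {u \<in> units. star u * u = 1}"

section \<open>The algebra of two by two matrices\<close>

(* The matrix product of HOL-Analysis requires the entries to lie in a semiring_1 (so 1 \<noteq> 0),
   and the multiplication of the type 'a^2^2 is componentwise, hence a separate type. *)

datatype 'a mat2 = Mat2 (ent11: 'a) (ent12: 'a) (ent21: 'a) (ent22: 'a)

instantiation mat2 :: (ring) ring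
begin

definition "0 = Mat2 0 0 0 0"
definition "A + B =
  Mat2 (ent11 A + ent11 B) (ent12 A + ent12 B) (ent21 A + ent21 B) (ent22 A + ent22 B)"
definition "A - B =
  Mat2 (ent11 A - ent11 B) (ent12 A - ent12 B) (ent21 A - ent21 B) (ent22 A - ent22 B)"
definition "- A = Mat2 (- ent11 A) (- ent12 A) (- ent21 A) (- ent22 A)"
definition "A * B =
  Mat2 (ent11 A * ent11 B + ent12 A * ent21 B) (ent11 A * ent12 B + ent12 A * ent22 B)
       (ent21 A * ent11 B + ent22 A * ent21 B) (ent21 A * ent12 B + ent22 A * ent22 B)"

instance
  by standard
    (simp_all add: zero_mat2_def plus_mat2_def minus_mat2_def uminus_mat2_def times_mat2_def
      algebra_simps)

end

instantiation mat2 :: ("{ring, monoid_mult}") monoid_mult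
begin

definition "1 = Mat2 1 0 0 1"

instance
  by standard (simp_all add: one_mat2_def times_mat2_def mult.assoc algebra_simps)

end

definition mat2_star :: "('a \<Rightarrow> 'a) \<Rightarrow> 'a mat2 \<Rightarrow> 'a mat2" where
  "mat2_star star A =
    Mat2 (star (ent11 A)) (star (ent21 A)) (star (ent12 A)) (star (ent22 A))"

section \<open>Flags\<close>

definition idempotents :: "'c::monoid_mult set" where
  "idempotents = {p. p * p = p}"

definition idem_le :: "'c::monoid_mult \<Rightarrow> 'c \<Rightarrow> bool" where
  "idem_le p q \<longleftrightarrow> q * p = p"

definition idem_equiv :: "'c::monoid_mult \<Rightarrow> 'c \<Rightarrow> bool" where
  "idem_equiv p q \<longleftrightarrow> p * q = q \<and> q * p = p"

definition idem_chains :: "nat \<Rightarrow> 'c::monoid_mult list set" where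
  "idem_chains n = {ps. length ps = n \<and> set ps \<subseteq> idempotents \<and> successively idem_le ps}"

definition flag_rel :: "nat \<Rightarrow> ('c::monoid_mult list \<times> 'c list) set" where
  "flag_rel n = {(ps, qs). ps \<in> idem_chains n \<and> qs \<in> idem_chains n \<and> list_all2 idem_equiv ps qs}"

definition flags :: "nat \<Rightarrow> 'c::monoid_mult list set set" where
  "flags n = idem_chains n // flag_rel n"

(* g [(p_1, ..., p_n)] = [(g p_1 g^-1, ..., g p_n g^-1)], see flag_act_class below. *)
definition flag_act :: "'c::monoid_mult \<Rightarrow> 'c list set \<Rightarrow> 'c list set" where
  "flag_act g X = map (\<lambda>p. g * p * unit_inv g) ` X"

definition flag_manifold :: "'c::monoid_mult list set \<Rightarrow> 'c list set set" where
  "flag_manifold X = {flag_act g X | g. g \<in> units}"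

definition acts_transitively_on :: "'g set \<Rightarrow> ('g \<Rightarrow> 'x \<Rightarrow> 'x) \<Rightarrow> 'x set \<Rightarrow> bool" where
  "acts_transitively_on G act S \<longleftrightarrow> (\<forall>x\<in>S. \<forall>y\<in>S. \<exists>g\<in>G. act g x = y)"

lemma equiv_flag_rel: "equiv (idem_chains n :: 'c::monoid_mult list set) (flag_rel n)"
proof (rule equivI)
  show "flag_rel n \<subseteq> idem_chains n \<times> idem_chains n"
    by (auto simp: flag_rel_def)
  show "refl_on (idem_chains n) (flag_rel n)"
    by (auto simp: refl_on_def flag_rel_def idem_chains_def idem_equiv_def idempotents_def
        list_all2_same)
  show "sym (flag_rel n)"
    by (auto simp: sym_def flag_rel_def idem_equiv_def list_all2_conv_all_nth)
  have idem_trans: "idem_equiv p r" if "idem_equiv p q" "idem_equiv q r" for p q r :: 'c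
  proof -
    have "p * (q * r) = (p * q) * r" "r * (q * p) = (r * q) * p"
      by (simp_all only: mult.assoc)
    then show ?thesis
      using that by (simp add: idem_equiv_def)
  qed
  have trans: "list_all2 idem_equiv ps rs"
    if "list_all2 idem_equiv ps qs" "list_all2 idem_equiv qs rs" for ps qs rs :: "'c list"
    using list_all2_trans[OF idem_trans that] .
  show "trans (flag_rel n :: ('c list \<times> 'c list) set)"
  proof (rule transI)
    fix ps qs rs :: "'c list"
    assume "(ps, qs) \<in> flag_rel n" "(qs, rs) \<in> flag_rel n"
    then show "(ps, rs) \<in> flag_rel n"
      using trans[of ps qs rs] by (simp add: flag_rel_def)
  qed
qed

lemma flag_act_class:
  fixes g :: "'c::monoid_mult"
  assumes g: "g \<in> units" and ps: "ps \<in> idem_chains n"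
  shows "map (\<lambda>p. g * p * unit_inv g) ps \<in> idem_chains n"
    and "flag_act g (flag_rel n `` {ps}) = flag_rel n `` {map (\<lambda>p. g * p * unit_inv g) ps}"
proof -
  define h where "h = unit_inv g"
  have gh: "g * h = 1" "h * g = 1"
    using units_inv[OF g] by (simp_all add: h_def)
  have conj_mult: "(a * p * b) * (a * q * b) = a * (p * q) * b" if "b * a = 1" for a b p q :: 'c
  proof -
    have "(a * p * b) * (a * q * b) = a * p * (b * a) * (q * b)"
      by (simp only: mult.assoc)
    then show ?thesis
      by (simp add: that mult.assoc)
  qed
  have conj_inv: "a * (b * p * a) * b = p" if "a * b = 1" for a b p :: 'c
  proof -
    have "a * (b * p * a) * b = (a * b) * p * (a * b)"
      by (simp only: mult.assoc)
    then show ?thesis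
      by (simp add: that)
  qed
  have chains: "map (\<lambda>p. a * p * b) qs \<in> idem_chains n"
    if "b * a = 1" "qs \<in> idem_chains n" for a b :: 'c and qs
  proof -
    have "successively (\<lambda>p q. idem_le (a * p * b) (a * q * b)) qs"
    proof (rule successively_mono)
      show "successively idem_le qs"
        using that(2) by (simp add: idem_chains_def)
    qed (simp add: idem_le_def conj_mult[OF that(1)])
    then show ?thesis
      using that(2)
      by (auto simp: idem_chains_def idempotents_def successively_map conj_mult[OF that(1)])
  qed
  have rel: "(map (\<lambda>p. a * p * b) qs, map (\<lambda>p. a * p * b) rs) \<in> flag_rel n"
    if "b * a = 1" "(qs, rs) \<in> flag_rel n" for a b :: 'c and qs rs
    using that(2) chains[OF that(1)]
    by (simp add: flag_rel_def idem_equiv_def list_all2_conv_all_nth conj_mult[OF that(1)])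
  show "map (\<lambda>p. g * p * unit_inv g) ps \<in> idem_chains n"
    using chains[OF gh(2) ps] by (simp add: h_def)
  have "flag_rel n `` {map (\<lambda>p. g * p * h) ps} \<subseteq> map (\<lambda>p. g * p * h) ` (flag_rel n `` {ps})"
  proof
    fix qs assume "qs \<in> flag_rel n `` {map (\<lambda>p. g * p * h) ps}"
    then have "(map (\<lambda>p. h * p * g) (map (\<lambda>p. g * p * h) ps), map (\<lambda>p. h * p * g) qs) \<in> flag_rel n"
      using rel[OF gh(1)] by blast
    then have "map (\<lambda>p. h * p * g) qs \<in> flag_rel n `` {ps}"
      by (simp add: comp_def conj_inv[OF gh(2)])
    moreover have "qs = map (\<lambda>p. g * p * h) (map (\<lambda>p. h * p * g) qs)"
      by (simp add: comp_def conj_inv[OF gh(1)])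
    ultimately show "qs \<in> map (\<lambda>p. g * p * h) ` (flag_rel n `` {ps})"
      by blast
  qed
  then show "flag_act g (flag_rel n `` {ps}) = flag_rel n `` {map (\<lambda>p. g * p * unit_inv g) ps}"
    using rel[OF gh(2)] unfolding flag_act_def h_def[symmetric] by blast
qed

end

(* If U_2(A) is transitive, a unitary carries the first coordinate line to the line spanned by (1, a);
   its first column is (1, a) c with c invertible, so c^* (1 + a^2) c = 1 and 1 + a^2 is invertible for
   every hermitian a.

   Conversely, let C be a Mackey-complete hermitian continuous inverse algebra with continuous
   involution. If the segment from 1 to b consists of units, then b^(-1/2) is the limit of the dyadic
   trapezoidal sums of (cos^2 t + b sin^2 t)^(-1), because the product of trapezoidal and midpoint sums
   is exactly b^(-1). In the same way the averages of (1 - z h)^(-1) over the 2^n-th roots of unity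
   converge to an idempotent, and a homotopy shows h^(2^n) -> 0 if the spectral radius of h is less
   than 1. With these two facts in place of functional calculus, Ptak's argument gives the
   Shirali-Ford theorem: 1 + t a^* a is invertible for all t >= 0. Via Schur complements M_2(A) is then
   hermitian too, so Shirali-Ford also holds in M_2(A).

   For C = M_2(A), every idempotent is equivalent to a self-adjoint one. If g carries a chain of
   projections to another one, the block diagonal part w of g is invertible and intertwines the two
   chains, and so does the unitary w (w^* w)^(-1/2). *)
theory Submission
  imports Defs
begin

section \<open>Units\<close>

text \<open>There is no norm, and Mackey completeness only gives limits of sequences whose
  differences shrink inside multiples of one bounded set. Dyadic averages of a curve whose
  difference quotients stay in a compact set form such a sequence, and pairing x with x + 1/2 yields
  exact algebraic identities at every finite stage, so no integral has to be evaluated. Behind the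
  square root stands the integral of d\<theta> / (a cos^2 \<theta> + b sin^2 \<theta>) over
  [0, \<pi>], which is \<pi> (a b)^(-1/2); angle doubling acts on the pair (a, b) like an
  arithmetic-geometric mean step. The idempotent must be 1 because an invertible idempotent is 1.
  Shirali-Ford enters at two levels: in A it supplies the square root that makes the Schur
  complement of i + H tractable, and in M_2(A) it puts the segment from 1 to
  \<open>star w * w\<close> inside the units, as the polar decomposition of w requires. The converse
  uses two rows because 1 + a^2 is the squared length of the column (1, a).\<close>

lemma unitsI: "a * b = 1 \<Longrightarrow> b * a = 1 \<Longrightarrow> a \<in> units"
  by (auto simp: units_def)

lemma one_in_units: "1 \<in> units"
  by (auto simp: units_def)

lemma unit_inv_in_units: "a \<in> units \<Longrightarrow> unit_inv a \<in> units"
  using units_inv unitsI by blast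

lemma units_mult:
  assumes "a \<in> units" "b \<in> units"
  shows "a * b \<in> units" "unit_inv (a * b) = unit_inv b * unit_inv a"
proof -
  have 1: "(a * b) * (unit_inv b * unit_inv a) = 1"
    by (metis assms mult.assoc mult_1_right units_inv(1))
  have 2: "(unit_inv b * unit_inv a) * (a * b) = 1"
    by (metis assms mult.assoc mult_1_right units_inv(2))
  show "a * b \<in> units" "unit_inv (a * b) = unit_inv b * unit_inv a"
    using unitsI[OF 1 2] unit_inv_eqI[OF 1 2] .
qed

lemma units_cancel_left:
  assumes "a * b \<in> units" "a \<in> units"
  shows "b \<in> units"
proof -
  have "unit_inv a * (a * b) = b"
    by (metis assms(2) mult.assoc mult_1_left units_inv(2))
  then show ?thesis
    by (metis assms units_mult(1) unit_inv_in_units)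
qed

lemma units_cancel_right:
  assumes "a * b \<in> units" "b \<in> units"
  shows "a \<in> units"
proof -
  have "(a * b) * unit_inv b = a"
    by (metis assms(2) mult.assoc mult_1_right units_inv(1))
  then show ?thesis
    by (metis assms units_mult(1) unit_inv_in_units)
qed

text \<open>One product gives a right inverse of \<open>a\<close>, the other a left inverse, and the
  two coincide.\<close>

lemma units_of_both_products:
  assumes "a * b \<in> units" "b * a \<in> units"
  shows "a \<in> units"
proof -
  have 1: "a * (b * unit_inv (a * b)) = 1"
    using units_inv(1)[OF assms(1)] by (simp add: mult.assoc)
  have 2: "(unit_inv (b * a) * b) * a = 1"
    using units_inv(2)[OF assms(2)] by (simp add: mult.assoc)
  have "unit_inv (b * a) * b = b * unit_inv (a * b)"
    by (metis 1 2 mult.assoc mult_1_left mult_1_right)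
  with 1 2 show ?thesis
    by (metis unitsI)
qed

lemma unit_inv_commute:
  assumes "a \<in> units" "a * x = x * a"
  shows "unit_inv a * x = x * unit_inv a"
  by (metis assms mult.assoc mult_1_left mult_1_right units_inv)

lemma unit_inv_inv: "a \<in> units \<Longrightarrow> unit_inv (unit_inv a) = a"
  using unit_inv_eqI units_inv by blast

lemma unit_inv_one: "unit_inv 1 = 1"
  by (rule unit_inv_eqI) auto

text \<open>The resolvent identity, source of the Lipschitz estimates for inverses.\<close>

lemma unit_inv_diff:
  fixes p q :: "'a::{ring, monoid_mult}"
  assumes "p \<in> units" "q \<in> units"
  shows "unit_inv p - unit_inv q = unit_inv p * (q - p) * unit_inv q"
  by (metis (no_types, lifting) assms left_diff_distrib mult.assoc mult_1_left mult_1_right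
      right_diff_distrib units_inv)

text \<open>Partial fractions; this drives the doubling identities for both kinds of
  averages.\<close>

lemma unit_inv_add:
  fixes p q :: "'a::{ring, monoid_mult}"
  assumes "p \<in> units" "q \<in> units" "p * q = q * p"
  shows "unit_inv p + unit_inv q = (p + q) * unit_inv (p * q)"
proof -
  have "(p + q) * unit_inv (p * q) = p * (unit_inv q * unit_inv p) + q * (unit_inv q * unit_inv p)"
    by (simp only: units_mult(2)[OF assms(1,2)] distrib_right)
  also have "p * (unit_inv q * unit_inv p) = unit_inv q"
    using unit_inv_commute[OF assms(2), of p] units_inv[OF assms(1)] assms(3)
    by (metis mult.assoc mult_1_right)
  also have "q * (unit_inv q * unit_inv p) = unit_inv p"
    using units_inv[OF assms(2)] by (metis mult.assoc mult_1_left)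
  finally show ?thesis
    by (simp add: add.commute)
qed

text \<open>Jacobson's lemma: the inverse of \<open>1 - b * a\<close> is
  \<open>1 + b * c * a\<close> with \<open>c\<close> the inverse of
  \<open>1 - a * b\<close>.\<close>

lemma one_minus_mult_swap:
  fixes a b :: "'a::{ring, monoid_mult}"
  assumes "1 - a * b \<in> units"
  shows "1 - b * a \<in> units"
proof (rule unitsI)
  define c where "c = unit_inv (1 - a * b)"
  have 1: "a * b * c = c - 1" "c * (a * b) = c - 1"
    using units_inv[OF assms] by (simp_all add: c_def left_diff_distrib right_diff_distrib algebra_simps)
  have "(1 - b * a) * (1 + b * c * a) = 1 + b * (c - 1 - a * b * c) * a"
    by (simp add: algebra_simps)
  then show "(1 - b * a) * (1 + b * c * a) = 1"
    using 1 by simp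
  have "(1 + b * c * a) * (1 - b * a) = 1 + b * (c - 1 - c * (a * b)) * a"
    by (simp add: algebra_simps)
  then show "(1 + b * c * a) * (1 - b * a) = 1"
    using 1 by simp
qed

section \<open>Scalars in continuous inverse algebras\<close>

context continuous_inverse_algebra
begin

sublocale scaleC: vector_space scaleC
  by (rule vector_space_scaleC)

lemma scaleC_mult_scaleC: "scaleC c x * scaleC d y = scaleC (c * d) (x * y)"
  by (simp add: mult_scaleC_left mult_scaleC_right mult.commute)

lemma units_scaleC_iff:
  assumes "c \<noteq> 0"
  shows "scaleC c x \<in> units \<longleftrightarrow> x \<in> units"
proof -
  have *: "scaleC c x \<in> units" if "x \<in> units" "c \<noteq> 0" for c x
  proof (rule unitsI)
    show "scaleC c x * scaleC (inverse c) (unit_inv x) = 1"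
      "scaleC (inverse c) (unit_inv x) * scaleC c x = 1"
      using that units_inv[OF that(1)] by (simp_all add: scaleC_mult_scaleC)
  qed
  show ?thesis
    using *[of x c] *[of "scaleC c x" "inverse c"] assms by auto
qed

lemma units_scaleR_iff: "r \<noteq> 0 \<Longrightarrow> r *\<^sub>R (x :: 'a) \<in> units \<longleftrightarrow> x \<in> units"
  using units_scaleC_iff[of "of_real r" x] by (simp add: scaleC_of_real)

lemma continuous_on_scaleC [continuous_intros]:
  fixes g :: "_ \<Rightarrow> 'a"
  assumes "continuous_on S f" "continuous_on S g"
  shows "continuous_on S (\<lambda>x. scaleC (f x) (g x))"
proof -
  have "continuous_on S ((\<lambda>(c, x). scaleC c x) \<circ> (\<lambda>x. (f x, g x)))"
    by (intro continuous_on_compose continuous_on_Pair assms continuous_on_subset[OF continuous_scaleC]) auto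
  then show ?thesis
    by (simp add: o_def)
qed

lemma continuous_on_scaleR' [continuous_intros]:
  fixes g :: "_ \<Rightarrow> 'a"
  assumes "continuous_on S f" "continuous_on S g"
  shows "continuous_on S (\<lambda>x. f x *\<^sub>R g x)"
proof -
  have "continuous_on S (\<lambda>x. scaleC (of_real (f x)) (g x))"
    using assms by (intro continuous_intros)
  then show ?thesis
    by (simp add: scaleC_of_real)
qed

lemma tendsto_scaleR_const:
  fixes f :: "_ \<Rightarrow> 'a"
  assumes "(f \<longlongrightarrow> l) F"
  shows "((\<lambda>x. r *\<^sub>R f x) \<longlongrightarrow> r *\<^sub>R l) F"
proof -
  have "isCont (\<lambda>x. r *\<^sub>R x) l"
    using continuous_on_scaleR'[of UNIV "\<lambda>_. r" "\<lambda>x. x"]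
    by (simp add: continuous_on_eq_continuous_at)
  then show ?thesis
    using assms by (rule isCont_tendsto_compose)
qed

lemma tendsto_scaleR_left:
  assumes "(f \<longlongrightarrow> l) F"
  shows "((\<lambda>r. f r *\<^sub>R (x :: 'a)) \<longlongrightarrow> l *\<^sub>R x) F"
proof -
  have "isCont (\<lambda>r. r *\<^sub>R x) l"
    using continuous_on_scaleR'[of UNIV "\<lambda>r. r" "\<lambda>_. x"]
    by (simp add: continuous_on_eq_continuous_at)
  then show ?thesis
    using assms by (rule isCont_tendsto_compose)
qed

lemma continuous_on_unit_inv [continuous_intros]:
  fixes f :: "_ \<Rightarrow> 'a"
  assumes "continuous_on S f" "\<And>x. x \<in> S \<Longrightarrow> f x \<in> units"
  shows "continuous_on S (\<lambda>x. unit_inv (f x))"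
  using continuous_on_compose2[OF continuous_unit_inv assms(1)] assms(2) by auto

lemma tendsto_unit_inv:
  fixes f :: "_ \<Rightarrow> 'a"
  assumes "(f \<longlongrightarrow> l) F" "l \<in> units"
  shows "((\<lambda>x. unit_inv (f x)) \<longlongrightarrow> unit_inv l) F"
proof -
  have "isCont unit_inv l"
    using continuous_on_eq_continuous_at[OF open_units, of unit_inv] continuous_unit_inv assms(2) by blast
  then show ?thesis
    using assms(1) by (rule isCont_tendsto_compose)
qed

section \<open>Bounded sets\<close>

lemma open_scaleR_image:
  assumes "open U" "t \<noteq> 0"
  shows "open ((*\<^sub>R) t ` (U :: 'a set))"
proof -
  have "(*\<^sub>R) t ` U = (*\<^sub>R) (inverse t) -` U"
  proof safe
    fix x assume "inverse t *\<^sub>R x \<in> U"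
    then show "x \<in> (*\<^sub>R) t ` U"
      using assms(2) by (intro image_eqI[of _ _ "inverse t *\<^sub>R x"]) auto
  qed (use assms in auto)
  moreover have "open ((*\<^sub>R) (inverse t) -` U)"
    using continuous_on_scaleR'[of UNIV "\<lambda>_. inverse t" "\<lambda>x. x"] assms(1)
    by (intro open_vimage) auto
  ultimately show ?thesis
    by simp
qed

lemma scaleR_image_mono:
  assumes "convex V" "0 \<in> V" "0 \<le> s" "s \<le> t"
  shows "(*\<^sub>R) s ` V \<subseteq> (*\<^sub>R) t ` (V :: 'a set)"
proof safe
  fix x assume x: "x \<in> V"
  show "s *\<^sub>R x \<in> (*\<^sub>R) t ` V"
  proof (cases "t = 0")
    case False
    have "(s / t) *\<^sub>R x + (1 - s / t) *\<^sub>R 0 \<in> V"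
      using assms False x by (intro convexD) (auto simp: field_simps)
    then show ?thesis
      using False by (intro image_eqI[of _ _ "(s / t) *\<^sub>R x"]) auto
  qed (use assms x in auto)
qed

text \<open>The dilates by 1, 2, 3, ... of a convex open neighbourhood of 0 increase and cover the
  space, so a single one contains \<open>K\<close>.\<close>

lemma tvs_bounded_compact:
  assumes "compact (K :: 'a set)"
  shows "tvs_bounded K"
  unfolding tvs_bounded_def
proof (intro allI impI)
  fix U :: "'a set" assume "open U" "0 \<in> U"
  then obtain V where V: "open V" "convex V" "0 \<in> V" "V \<subseteq> U"
    using locally_convex by blast
  have "K \<subseteq> (\<Union>n::nat. (*\<^sub>R) (real (Suc n)) ` V)"
  proof
    fix x :: 'a
    have "(\<lambda>n. inverse (real (Suc n)) *\<^sub>R x) \<longlonglongrightarrow> 0"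
      using tendsto_scaleR_left[OF LIMSEQ_inverse_real_of_nat, of x] by simp
    then obtain n where "inverse (real (Suc n)) *\<^sub>R x \<in> V"
      using V by (metis (mono_tags, lifting) topological_tendstoD eventually_sequentially order_refl)
    then have "x \<in> (*\<^sub>R) (real (Suc n)) ` V"
      by (intro image_eqI[of _ _ "inverse (real (Suc n)) *\<^sub>R x"]) auto
    then show "x \<in> (\<Union>n. (*\<^sub>R) (real (Suc n)) ` V)"
      by blast
  qed
  then obtain N where N: "finite N" "K \<subseteq> (\<Union>n\<in>N. (*\<^sub>R) (real (Suc n)) ` V)"
    using compactE_image[OF assms, of UNIV "\<lambda>n. (*\<^sub>R) (real (Suc n)) ` V"] open_scaleR_image[OF V(1)]
    by (metis UNIV_I of_nat_eq_0_iff nat.distinct(2))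
  \<comment> \<open>\<open>insert 0\<close> keeps the maximum defined when \<open>N\<close> is
    empty.\<close>
  have "K \<subseteq> (*\<^sub>R) (real (Suc (Max (insert 0 N)))) ` U"
  proof
    fix x assume "x \<in> K"
    then obtain n where n: "n \<in> N" "x \<in> (*\<^sub>R) (real (Suc n)) ` V"
      using N by blast
    moreover have "n \<le> Max (insert 0 N)"
      using n N by (intro Max_ge) auto
    ultimately have "x \<in> (*\<^sub>R) (real (Suc (Max (insert 0 N)))) ` V"
      using scaleR_image_mono[OF V(2,3), of "real (Suc n)" "real (Suc (Max (insert 0 N)))"] by auto
    then show "x \<in> (*\<^sub>R) (real (Suc (Max (insert 0 N)))) ` U"
      using V by blast
  qed
  then show "\<exists>t>0. K \<subseteq> (*\<^sub>R) t ` U"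
    by (intro exI[of _ "real (Suc (Max (insert 0 N)))"]) auto
qed

lemma tvs_bounded_convex_hull:
  assumes "tvs_bounded (K :: 'a set)"
  shows "tvs_bounded (convex hull K)"
  unfolding tvs_bounded_def
proof (intro allI impI)
  fix U :: "'a set" assume "open U" "0 \<in> U"
  then obtain V where V: "open V" "convex V" "0 \<in> V" "V \<subseteq> U"
    using locally_convex by blast
  then obtain t where "t > 0" "K \<subseteq> (*\<^sub>R) t ` V"
    using assms by (auto simp: tvs_bounded_def)
  then have "convex hull K \<subseteq> (*\<^sub>R) t ` V"
    using V by (intro hull_minimal convex_scaling) auto
  then show "\<exists>t>0. convex hull K \<subseteq> (*\<^sub>R) t ` U"
    using V \<open>t > 0\<close> by blast
qed

end

section \<open>Dyadic averages of Lipschitz curves\<close>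

text \<open>A Riemann sum over [0, 1] with 2^n cells sampled at relative position \<delta>. For
  \<delta> = 1/2 it is the midpoint sum; for \<delta> = 0 and \<open>F\<close> of period 1 it is the
  trapezoidal sum.\<close>

definition dyadic_avg :: "real \<Rightarrow> (real \<Rightarrow> 'a::real_vector) \<Rightarrow> nat \<Rightarrow> 'a" where
  "dyadic_avg \<delta> F n = (1 / 2 ^ n) *\<^sub>R (\<Sum>k<2 ^ n. F ((real k + \<delta>) / 2 ^ n))"

text \<open>A Lipschitz condition without a norm: difference quotients lie in \<open>B\<close>. The
  image form avoids a division by zero.\<close>

definition lipschitz_into :: "'a::real_vector set \<Rightarrow> (real \<Rightarrow> 'a) \<Rightarrow> bool" where
  "lipschitz_into B F \<longleftrightarrow> (\<forall>x\<in>{0..1}. \<forall>y\<in>{0..1}. F x - F y \<in> (*\<^sub>R) \<bar>x - y\<bar> ` B)"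

lemma convex_average:
  assumes "convex S" "N > 0" "\<And>k. k < N \<Longrightarrow> f k \<in> S"
  shows "(1 / real N) *\<^sub>R (\<Sum>k<N. f k) \<in> S"
  unfolding scaleR_sum_right using assms by (intro convex_sum) auto

lemma convex_scaleR_add:
  assumes "convex B" "0 \<le> s" "0 \<le> t" "x \<in> (*\<^sub>R) s ` B" "y \<in> (*\<^sub>R) t ` B"
  shows "x + y \<in> (*\<^sub>R) (s + t) ` B"
proof -
  obtain u v where uv: "u \<in> B" "v \<in> B" "x = s *\<^sub>R u" "y = t *\<^sub>R v"
    using assms by auto
  show ?thesis
  proof (cases "s + t = 0")
    case True
    with assms have "s = 0" "t = 0"
      by auto
    with uv show ?thesis
      by auto
  next
    case False
    have "(s / (s + t)) *\<^sub>R u + (t / (s + t)) *\<^sub>R v \<in> B"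
      using assms uv False by (intro convexD) (auto simp: field_simps add_nonneg_eq_0_iff)
    then show ?thesis
      using uv False
      by (intro image_eqI[of _ _ "(s / (s + t)) *\<^sub>R u + (t / (s + t)) *\<^sub>R v"])
        (auto simp: scaleR_right_distrib)
  qed
qed

lemma sum_lessThan_double:
  "(\<Sum>k<2 * N. f k) = (\<Sum>k<N. f (2 * k)) + (\<Sum>k<(N::nat). f (2 * k + 1) :: 'a::comm_monoid_add)"
  by (induction N) (auto simp: algebra_simps)

lemma sum_lessThan_halves:
  "(\<Sum>k<2 * N. f k) = (\<Sum>k<(N::nat). f k + f (k + N) :: 'a::comm_monoid_add)"
proof -
  have "(\<Sum>k<2 * N. f k) = (\<Sum>k<N. f k) + (\<Sum>k=N..<2 * N. f k)"
    by (metis atLeast0LessThan le_add1 mult_2 sum.atLeastLessThan_concat zero_le)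
  also have "(\<Sum>k=N..<2 * N. f k) = (\<Sum>k<N. f (k + N))"
    using sum.shift_bounds_nat_ivl[of f 0 N N] by (simp add: mult_2 atLeast0LessThan)
  finally show ?thesis
    by (simp add: sum.distrib)
qed

lemma dyadic_avg_Suc:
  "dyadic_avg 0 F (Suc n) = (1 / 2) *\<^sub>R (dyadic_avg 0 F n + dyadic_avg (1 / 2) F n)"
proof -
  have "(real k + 1 / 2) / 2 ^ n = (2 * real k + 1) / (2 * 2 ^ n)" for k
    by (simp add: field_simps)
  then show ?thesis
    by (simp add: dyadic_avg_def sum_lessThan_double scaleR_right_distrib flip: divide_divide_eq_left)
      (simp add: field_simps)
qed

text \<open>The 2^(n+1) sample points split into pairs x, x + 1/2 whose first members double to the
  2^n sample points with the same offset \<delta>. Thus one identity serves trapezoidal and midpoint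
  sums.\<close>

lemma dyadic_avg_doubling:
  fixes c :: "'a::real_algebra"
  assumes "\<And>x. F x + F (x + 1 / 2) = 2 *\<^sub>R (c * G (2 * x))"
  shows "dyadic_avg \<delta> F (Suc n) = c * dyadic_avg \<delta> G n"
proof -
  have "F ((real k + \<delta>) / 2 ^ Suc n) + F ((real (k + 2 ^ n) + \<delta>) / 2 ^ Suc n) =
      2 *\<^sub>R (c * G ((real k + \<delta>) / 2 ^ n))" for k
  proof -
    have "(real (k + 2 ^ n) + \<delta>) / 2 ^ Suc n = (real k + \<delta>) / 2 ^ Suc n + 1 / 2"
      by (simp add: field_simps)
    moreover have "2 * ((real k + \<delta>) / 2 ^ Suc n) = (real k + \<delta>) / 2 ^ n"
      by (simp add: field_simps)
    ultimately show ?thesis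
      using assms[of "(real k + \<delta>) / 2 ^ Suc n"] by (simp only:)
  qed
  then have "(\<Sum>k<2 ^ Suc n. F ((real k + \<delta>) / 2 ^ Suc n)) =
      2 *\<^sub>R (c * (\<Sum>k<2 ^ n. G ((real k + \<delta>) / 2 ^ n)))"
    by (simp only: power_Suc sum_lessThan_halves) (simp add: scaleR_sum_right sum_distrib_left)
  then show ?thesis
    by (simp only: dyadic_avg_def) simp
qed

lemma dyadic_avg_diff_mem:
  assumes "convex S" "\<And>k. k < 2 ^ n \<Longrightarrow>
    F ((real k + \<delta>) / 2 ^ n) - G ((real k + \<epsilon>) / 2 ^ n) \<in> S"
  shows "dyadic_avg \<delta> F n - dyadic_avg \<epsilon> G n \<in> S"
  using convex_average[OF assms(1) _ assms(2), of "2 ^ n" ]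
  by (simp add: dyadic_avg_def sum_subtractf scaleR_right_diff_distrib)

locale mackey_complete_cia = continuous_inverse_algebra scaleC
  for scaleC :: "complex \<Rightarrow> 'a \<Rightarrow>
    'a::{real_algebra, monoid_mult, t2_space, topological_ab_group_add, topological_semigroup_mult}" +
  assumes mackey_complete: "mackey_complete TYPE('a)"
begin

text \<open>Averages may leave a compact set but not its symmetric convex hull, which is still
  bounded.\<close>

lemma compact_subset_disc:
  assumes "compact K"
  obtains B :: "'a set" where "convex B" "tvs_bounded B" "K \<subseteq> B" "0 \<in> B" "\<And>x. x \<in> B \<Longrightarrow> - x \<in> B"
proof
  let ?S = "insert 0 (K \<union> uminus ` K)"
  have "compact (uminus ` K)"
    using assms by (intro compact_continuous_image) (auto intro!: continuous_intros)
  then show "tvs_bounded (convex hull ?S)"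
    using assms by (intro tvs_bounded_convex_hull tvs_bounded_compact compact_insert compact_Un)
  show "- x \<in> convex hull ?S" if "x \<in> convex hull ?S" for x
  proof -
    have "uminus ` (convex hull ?S) = convex hull (uminus ` ?S)"
      using convex_hull_linear_image[OF linear_uminus, of ?S] by simp
    also have "uminus ` ?S = ?S"
      by (auto simp: image_Un image_image)
    finally show ?thesis
      using that by blast
  qed
qed (auto intro: hull_inc)

text \<open>Midpoint and trapezoidal sums of one level differ by half a cell width times an element
  of \<open>B\<close>, so the trapezoidal sums are Mackey-Cauchy with geometric rate.\<close>

lemma dyadic_avg_convergent:
  fixes F :: "real \<Rightarrow> 'a"
  assumes B: "convex B" "tvs_bounded B" "0 \<in> B" "\<And>x. x \<in> B \<Longrightarrow> - x \<in> B"
    and F: "lipschitz_into B F"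
  obtains L where "dyadic_avg 0 F \<longlonglongrightarrow> L" "dyadic_avg (1 / 2) F \<longlonglongrightarrow> L"
proof -
  let ?D = "dyadic_avg 0 F" and ?M = "dyadic_avg (1 / 2) F"
  have mid: "?M n - ?D n \<in> (*\<^sub>R) (1 / 2 ^ Suc n) ` B" for n
  proof (rule dyadic_avg_diff_mem)
    fix k :: nat assume "k < 2 ^ n"
    then have k: "real k + 1 \<le> 2 ^ n"
      by (metis Suc_leI of_nat_Suc of_nat_le_iff of_nat_numeral of_nat_power add.commute)
    have "F ((real k + 1 / 2) / 2 ^ n) - F ((real k + 0) / 2 ^ n) \<in>
        (*\<^sub>R) \<bar>(real k + 1 / 2) / 2 ^ n - (real k + 0) / 2 ^ n\<bar> ` B"
      using k \<open>k < 2 ^ n\<close>[THEN less_imp_le] F by (intro F[unfolded lipschitz_into_def, rule_format]) (auto simp: field_simps)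
    also have "(real k + 1 / 2) / 2 ^ n - (real k + 0) / 2 ^ n = 1 / 2 ^ Suc n"
      by (simp add: field_simps)
    finally show "F ((real k + 1 / 2) / 2 ^ n) - F ((real k + 0) / 2 ^ n) \<in> (*\<^sub>R) (1 / 2 ^ Suc n) ` B"
      by simp
  qed (use B in \<open>intro convex_scaling\<close>)
  have step: "?D (Suc n) - ?D n \<in> (*\<^sub>R) (1 / 2 ^ Suc n) ` B" for n
  proof -
    have "?D (Suc n) - ?D n = (1 / 2) *\<^sub>R (?M n - ?D n) + (1 / 2) *\<^sub>R 0"
      using scaleR_half_double[of "?D n"] by (simp add: dyadic_avg_Suc algebra_simps)
    also have "\<dots> \<in> (*\<^sub>R) (1 / 2 ^ Suc n) ` B"
      using B mid by (intro convexD[OF convex_scaling]) auto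
    finally show ?thesis .
  qed
  have diff: "?D (n + j) - ?D n \<in> (*\<^sub>R) (1 / 2 ^ n - 1 / 2 ^ (n + j)) ` B" for n j
  proof (induction j)
    case (Suc j)
    have "?D (n + Suc j) - ?D n = (?D (n + j) - ?D n) + (?D (Suc (n + j)) - ?D (n + j))"
      by simp
    also have "\<dots> \<in> (*\<^sub>R) ((1 / 2 ^ n - 1 / 2 ^ (n + j)) + 1 / 2 ^ Suc (n + j)) ` B"
      using B Suc step[of "n + j"] by (intro convex_scaleR_add) (auto simp: field_simps power_add)
    also have "(1 / 2 ^ n - 1 / 2 ^ (n + j)) + 1 / 2 ^ Suc (n + j) = (1 / 2 ^ n - 1 / 2 ^ (n + Suc j) :: real)"
      by (simp add: field_simps)
    finally show ?case .
  qed (use B in auto)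
  have le: "?D m - ?D n \<in> (*\<^sub>R) (1 / 2 ^ min m n) ` B" if "n \<le> m" for m n
  proof -
    have "?D m - ?D n \<in> (*\<^sub>R) (1 / 2 ^ n - 1 / 2 ^ m) ` B"
      using diff[of n "m - n"] that by simp
    moreover have "1 / 2 ^ n - 1 / 2 ^ m \<le> (1 / 2 ^ min m n :: real)" "0 \<le> 1 / 2 ^ n - 1 / (2 ^ m :: real)"
      using that by (auto simp: field_simps min_def)
    ultimately show ?thesis
      using scaleR_image_mono[OF B(1,3)] by blast
  qed
  have "?D m - ?D n \<in> (*\<^sub>R) (1 / 2 ^ min m n) ` B" for m n
  proof (cases "n \<le> m")
    case False
    then obtain x where "x \<in> B" "?D n - ?D m = (1 / 2 ^ min m n) *\<^sub>R x"
      using le[of m n] by (auto simp: min.commute)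
    then show ?thesis
      using B(4) by (intro image_eqI[of _ _ "- x"]) (auto simp: algebra_simps)
  qed (use le in blast)
  moreover have "((\<lambda>p. 1 / 2 ^ min (fst p) (snd p)) \<longlongrightarrow> (0::real)) (sequentially \<times>\<^sub>F sequentially)"
  proof (rule tendsto_sandwich[OF _ _ tendsto_const])
    have "(\<lambda>n. (1 / 2 :: real) ^ n) \<longlonglongrightarrow> 0"
      by (intro LIMSEQ_power_zero) auto
    from filterlim_compose[OF this filterlim_fst] filterlim_compose[OF this filterlim_snd]
    show "((\<lambda>p. (1 / 2) ^ fst p + (1 / 2) ^ snd p) \<longlongrightarrow> (0::real)) (sequentially \<times>\<^sub>F sequentially)"
      using tendsto_add by fastforce
    show "\<forall>\<^sub>F p in sequentially \<times>\<^sub>F sequentially. 1 / 2 ^ min (fst p) (snd p) \<le> (1 / 2) ^ fst p + (1 / 2 :: real) ^ snd p"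
      by (auto intro!: always_eventually simp: min_def power_one_over)
  qed auto
  ultimately have "mackey_Cauchy ?D"
    unfolding mackey_Cauchy_def using B
    by (intro exI[of _ B] exI[of _ "\<lambda>p. 1 / 2 ^ min (fst p) (snd p)"]) auto
  then obtain L where L: "?D \<longlonglongrightarrow> L"
    using mackey_complete by (auto simp: mackey_complete_def convergent_def)
  \<comment> \<open>Two consecutive trapezoidal sums determine the midpoint sum, which therefore has
    the same limit.\<close>
  have "(\<lambda>n. 2 *\<^sub>R ?D (Suc n) - ?D n) \<longlonglongrightarrow> 2 *\<^sub>R L - L"
    by (intro tendsto_diff tendsto_scaleR_const LIMSEQ_Suc L)
  moreover have "2 *\<^sub>R ?D (Suc n) - ?D n = ?M n" for n
    by (simp add: dyadic_avg_Suc)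
  moreover have "2 *\<^sub>R L - L = L"
    by (simp add: scaleR_2)
  ultimately have "?M \<longlonglongrightarrow> L"
    by simp
  with L show ?thesis
    using that by blast
qed

end

section \<open>Square roots\<close>

text \<open>The segment from \<open>a\<close> to \<open>b\<close>, parametrised by an angle because
  a shift of \<theta> by \<pi>/2 swaps the weights.\<close>

definition pencil :: "'a::real_vector \<Rightarrow> 'a \<Rightarrow> real \<Rightarrow> 'a" where
  "pencil a b \<theta> = (cos \<theta>)\<^sup>2 *\<^sub>R a + (sin \<theta>)\<^sup>2 *\<^sub>R b"

definition unit_segment :: "'a::{real_algebra, monoid_mult} \<Rightarrow> 'a \<Rightarrow> bool" where
  "unit_segment a b \<longleftrightarrow> (\<forall>t\<in>{0..1}. (1 - t) *\<^sub>R a + t *\<^sub>R b \<in> units)"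

lemma pencil_in_units: "unit_segment a b \<Longrightarrow> pencil a b \<theta> \<in> units"
  unfolding unit_segment_def pencil_def cos_squared_eq
  by (auto simp: abs_square_le_1)

lemma pencil_commute: "a * x = x * a \<Longrightarrow> b * x = x * b \<Longrightarrow> pencil a b \<theta> * x = x * pencil a b \<theta>"
  for a b x :: "'a::real_algebra"
  by (simp add: pencil_def algebra_simps)

text \<open>With C, S the squared cosine and sine, C^2 + S^2 = (C - S)^2 + 2 C S, and the summand 2
  C S completes a^2 + b^2 to (a + b)^2.\<close>

lemma pencil_mult_shift:
  fixes a b :: "'a::real_algebra"
  assumes "a * b = b * a"
  shows "pencil a b \<theta> * pencil a b (\<theta> + pi / 2) = pencil (a * b) ((1 / 4) *\<^sub>R ((a + b) * (a + b))) (2 * \<theta>)"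
proof -
  define C S where "C = (cos \<theta>)\<^sup>2" and "S = (sin \<theta>)\<^sup>2"
  have shift: "(cos (\<theta> + pi / 2))\<^sup>2 = S" "(sin (\<theta> + pi / 2))\<^sup>2 = C"
    by (simp_all add: cos_add sin_add C_def S_def)
  have double: "(cos (2 * \<theta>))\<^sup>2 = (C - S)\<^sup>2" "(sin (2 * \<theta>))\<^sup>2 = 4 * (C * S)"
    by (simp_all add: cos_double sin_double C_def S_def power_mult_distrib)
  have "pencil a b \<theta> * pencil a b (\<theta> + pi / 2) = (C *\<^sub>R a + S *\<^sub>R b) * (S *\<^sub>R a + C *\<^sub>R b)"
    by (simp only: pencil_def shift C_def[symmetric] S_def[symmetric])
  also have "\<dots> = (C * S) *\<^sub>R (a * a + b * b) + (C * C + S * S) *\<^sub>R (a * b)"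
    by (simp add: algebra_simps assms)
  also have "C * C + S * S = (C - S)\<^sup>2 + 2 * (C * S)"
    by (simp add: power2_eq_square algebra_simps)
  also have "(C * S) *\<^sub>R (a * a + b * b) + ((C - S)\<^sup>2 + 2 * (C * S)) *\<^sub>R (a * b) =
      (C - S)\<^sup>2 *\<^sub>R (a * b) + (C * S) *\<^sub>R ((a + b) * (a + b))"
  proof -
    have "(a + b) * (a + b) = (a * a + b * b) + 2 *\<^sub>R (a * b)"
      by (simp add: distrib_left distrib_right assms scaleR_2 add_ac)
    then show ?thesis
      by (simp only: scaleR_add_left scaleR_add_right scaleR_scaleR add_ac mult.commute[of 2])
  qed
  also have "\<dots> = pencil (a * b) ((1 / 4) *\<^sub>R ((a + b) * (a + b))) (2 * \<theta>)"
    by (simp add: pencil_def double)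
  finally show ?thesis .
qed

lemma unit_segment_double:
  assumes "a * b = b * a" "unit_segment a b"
  shows "unit_segment (a * b) ((1 / 4) *\<^sub>R ((a + b) * (a + b)))"
  unfolding unit_segment_def
proof
  fix t :: real assume t: "t \<in> {0..1}"
  \<comment> \<open>Chosen so that sin^2 (2 \<theta>) = t: each point of the new segment is a
    product of two points of the old one.\<close>
  define \<theta> where "\<theta> = arcsin (sqrt t) / 2"
  have "(sin (2 * \<theta>))\<^sup>2 = t" "(cos (2 * \<theta>))\<^sup>2 = 1 - t"
    using t order_trans[OF _ real_sqrt_ge_zero, of "-1" t] by (simp_all add: \<theta>_def cos_squared_eq)
  then have "(1 - t) *\<^sub>R (a * b) + t *\<^sub>R ((1 / 4) *\<^sub>R ((a + b) * (a + b))) =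
      pencil a b \<theta> * pencil a b (\<theta> + pi / 2)"
    unfolding pencil_mult_shift[OF assms(1)] by (simp only: pencil_def)
  then show "(1 - t) *\<^sub>R (a * b) + t *\<^sub>R ((1 / 4) *\<^sub>R ((a + b) * (a + b))) \<in> units"
    by (simp only: units_mult(1) pencil_in_units[OF assms(2)])
qed

text \<open>The factor \<open>pi\<close> gives the curve period 1.\<close>

definition pencil_inv :: "'a::{real_algebra, monoid_mult} \<Rightarrow> 'a \<Rightarrow> real \<Rightarrow> 'a" where
  "pencil_inv a b x = unit_inv (pencil a b (pi * x))"

text \<open>Partial fractions for two pencil values a quarter turn apart, whose sum is the constant
  a + b.\<close>

lemma pencil_inv_doubling:
  assumes ab: "a * b = b * a" "unit_segment a b"
  shows "pencil_inv a b x + pencil_inv a b (x + 1 / 2) =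
    2 *\<^sub>R (((1 / 2) *\<^sub>R (a + b)) * pencil_inv (a * b) ((1 / 4) *\<^sub>R ((a + b) * (a + b))) (2 * x))"
proof -
  define p q where "p = pencil a b (pi * x)" and "q = pencil a b (pi * x + pi / 2)"
  have units: "p \<in> units" "q \<in> units"
    by (simp_all add: p_def q_def pencil_in_units ab)
  have sum: "p + q = a + b"
  proof -
    have "p + q = ((cos (pi * x))\<^sup>2 + (sin (pi * x))\<^sup>2) *\<^sub>R a + ((cos (pi * x))\<^sup>2 + (sin (pi * x))\<^sup>2) *\<^sub>R b"
      by (simp add: p_def q_def pencil_def cos_add sin_add scaleR_add_left
          del: sin_cos_squared_add sin_cos_squared_add2)
    then show ?thesis
      by simp
  qed
  have pq: "p * q = pencil (a * b) ((1 / 4) *\<^sub>R ((a + b) * (a + b))) (pi * (2 * x))"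
    using pencil_mult_shift[OF ab(1), of "pi * x"] by (simp add: p_def q_def mult_ac)
  have com: "p * q = q * p"
    unfolding p_def q_def using ab
    by (intro pencil_commute) (auto simp: pencil_def algebra_simps)
  have "unit_inv p + unit_inv q = 2 *\<^sub>R ((1 / 2) *\<^sub>R (a + b) * unit_inv (p * q))"
    by (simp add: unit_inv_add units com sum)
  moreover have "pencil_inv a b x = unit_inv p" "pencil_inv a b (x + 1 / 2) = unit_inv q"
    by (simp_all add: pencil_inv_def p_def q_def distrib_left)
  ultimately show ?thesis
    by (simp only: pencil_inv_def pq)
qed

lemma dyadic_avg_commute:
  fixes x :: "'a::real_algebra"
  assumes "\<And>t. F t * x = x * F t"
  shows "dyadic_avg \<delta> F n * x = x * dyadic_avg \<delta> F n"
  by (simp add: dyadic_avg_def sum_distrib_left sum_distrib_right assms)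

lemma pencil_inv_commute:
  assumes "unit_segment a b" "a * x = x * a" "b * x = x * b"
  shows "pencil_inv a b t * x = x * pencil_inv a b t"
  unfolding pencil_inv_def using assms by (intro unit_inv_commute pencil_in_units pencil_commute)

text \<open>The doubling step is the arithmetic-geometric mean \<open>(a, b) \<mapsto> (a b, ((a + b) / 2)\<^sup>2)\<close>;
  the trapezoidal sum \<open>T\<close> and the midpoint sum \<open>M\<close> both acquire the factor \<open>(a + b) / 2\<close>,
  so \<open>a b T M\<close> is invariant.\<close>

lemma trapezoidal_mult_midpoint:
  fixes a b :: "'a::{real_algebra, monoid_mult}"
  assumes "a * b = b * a" "unit_segment a b"
  shows "a * b * dyadic_avg 0 (pencil_inv a b) n * dyadic_avg (1 / 2) (pencil_inv a b) n = 1"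
  using assms
proof (induction n arbitrary: a b)
  \<comment> \<open>With a single cell the two sums are the values at the angles 0 and \<pi>/2, the
    inverses of \<open>a\<close> and \<open>b\<close>.\<close>
  case 0
  have ab: "a \<in> units" "b \<in> units"
    using pencil_in_units[OF 0(2), of 0] pencil_in_units[OF 0(2), of "pi / 2"] by (simp_all add: pencil_def)
  have "a * b * unit_inv a * unit_inv b = 1"
    by (metis 0(1) ab mult.assoc mult_1_right units_inv(1))
  then show ?case
    by (simp add: dyadic_avg_def pencil_inv_def pencil_def)
next
  case (Suc n)
  define m where "m = (1 / 2) *\<^sub>R (a + b)"
  define b' where "b' = (1 / 4) *\<^sub>R ((a + b) * (a + b))"
  define T M where "T = dyadic_avg 0 (pencil_inv (a * b) b') n"
    and "M = dyadic_avg (1 / 2) (pencil_inv (a * b) b') n"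
  have b'_m: "b' = m * m"
    by (simp add: b'_def m_def)
  have com: "a * (a * b) = (a * b) * a" "b * (a * b) = (a * b) * b"
    using Suc.prems(1) by (metis mult.assoc)+
  have seg: "unit_segment (a * b) b'"
    unfolding b'_def using Suc.prems by (rule unit_segment_double)
  have cm: "a * b * m = m * (a * b)"
    using com by (simp add: m_def distrib_left distrib_right)
  have "dyadic_avg \<delta> (pencil_inv a b) (Suc n) = m * dyadic_avg \<delta> (pencil_inv (a * b) b') n" for \<delta>
    unfolding m_def b'_def using Suc.prems by (intro dyadic_avg_doubling pencil_inv_doubling)
  moreover have "a * b * (m * T) * (m * M) = a * b * b' * T * M"
  proof -
    have "T * m = m * T"
      unfolding T_def using seg cm
      by (intro dyadic_avg_commute pencil_inv_commute) (simp_all add: b'_m mult.assoc)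
    then show ?thesis
      by (metis b'_m mult.assoc)
  qed
  moreover have "a * b * b' * T * M = 1"
    unfolding T_def M_def using seg cm by (intro Suc.IH) (simp_all add: b'_m, metis mult.assoc)
  ultimately show ?case
    by (simp add: T_def M_def)
qed

section \<open>Convergence of the sums and the inverse square root\<close>

context mackey_complete_cia
begin

lemma dyadic_avg_convergent_compact:
  fixes F :: "real \<Rightarrow> 'a"
  assumes "compact K" "lipschitz_into K F"
  obtains L where "dyadic_avg 0 F \<longlonglongrightarrow> L" "dyadic_avg (1 / 2) F \<longlonglongrightarrow> L"
proof -
  obtain B where B: "convex B" "tvs_bounded B" "K \<subseteq> B" "0 \<in> B" "\<And>x. x \<in> B \<Longrightarrow> - x \<in> (B :: 'a set)"
    using compact_subset_disc[OF assms(1)] by metis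
  moreover have "lipschitz_into B F"
    using assms(2) B(3) unfolding lipschitz_into_def by blast
  ultimately show ?thesis
    using dyadic_avg_convergent[of B F] that by metis
qed

text \<open>By the resolvent identity each difference quotient is r F(x) (b - a) F(y), where r is,
  up to sign, a difference quotient of sin^2 (\<pi> x). It is bounded by \<pi>, so 8 leaves ample
  room.\<close>

lemma lipschitz_into_pencil_inv:
  assumes "unit_segment a (b :: 'a)"
  obtains K where "compact K" "lipschitz_into K (pencil_inv a b)"
proof
  let ?f = "\<lambda>p :: real \<times> real \<times> real. fst p *\<^sub>R (pencil_inv a b (fst (snd p)) * (b - a) * pencil_inv a b (snd (snd p)))"
  let ?K = "?f ` ({-8..8} \<times> {0..1} \<times> {0..1})"
  have "continuous_on ({-8..8} \<times> {0..1} \<times> {0..1}) ?f"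
    unfolding pencil_inv_def pencil_def
    by (intro continuous_intros; rule pencil_in_units[OF assms, unfolded pencil_def])
  then show "compact ?K"
    by (intro compact_continuous_image compact_Times) auto
  show "lipschitz_into ?K (pencil_inv a b)"
    unfolding lipschitz_into_def
  proof (intro ballI)
    fix x y :: real assume xy: "x \<in> {0..1}" "y \<in> {0..1}"
    \<comment> \<open>For x = y the default value of division gives r = 0, so the product formula
      holds there too.\<close>
    define r where "r = ((sin (pi * y))\<^sup>2 - (sin (pi * x))\<^sup>2) / \<bar>x - y\<bar>"
    have r: "r * \<bar>x - y\<bar> = (sin (pi * y))\<^sup>2 - (sin (pi * x))\<^sup>2"
      by (auto simp: r_def)
    have "\<bar>(sin (pi * y))\<^sup>2 - (sin (pi * x))\<^sup>2\<bar> \<le> 8 * \<bar>x - y\<bar>"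
    proof -
      have "(sin (pi * y))\<^sup>2 - (sin (pi * x))\<^sup>2 = sin (pi * y + pi * x) * sin (pi * y - pi * x)"
        unfolding sin_add sin_diff
        using sin_cos_squared_add[of "pi * x"] sin_cos_squared_add[of "pi * y"] by algebra
      moreover have "\<bar>sin (pi * y + pi * x) * sin (pi * y - pi * x)\<bar> \<le> 1 * \<bar>pi * y - pi * x\<bar>"
        unfolding abs_mult by (intro mult_mono abs_sin_x_le_abs_x) auto
      moreover have "\<bar>pi * y - pi * x\<bar> = pi * \<bar>x - y\<bar>"
        by (simp add: abs_minus_commute abs_mult flip: right_diff_distrib)
      moreover have "pi * \<bar>x - y\<bar> \<le> 8 * \<bar>x - y\<bar>"
        using pi_less_4 by (intro mult_right_mono) auto
      ultimately show ?thesis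
        by simp
    qed
    then have r8: "r \<in> {-8..8}"
      by (cases "x = y") (auto simp: r_def field_simps abs_le_iff)
    define p q where "p = pencil a b (pi * x)" and "q = pencil a b (pi * y)"
    have units: "p \<in> units" "q \<in> units"
      by (simp_all add: p_def q_def pencil_in_units assms)
    have "unit_inv p - unit_inv q = unit_inv p * (q - p) * unit_inv q"
      using units by (rule unit_inv_diff)
    also have "q - p = (r * \<bar>x - y\<bar>) *\<^sub>R (b - a)"
      unfolding r by (simp add: p_def q_def pencil_def cos_squared_eq algebra_simps)
    finally have "pencil_inv a b x - pencil_inv a b y = \<bar>x - y\<bar> *\<^sub>R ?f (r, x, y)"
      by (simp add: pencil_inv_def p_def q_def mult.commute)
    then show "pencil_inv a b x - pencil_inv a b y \<in> (*\<^sub>R) \<bar>x - y\<bar> ` ?K"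
      using xy r8 by blast
  qed
qed

text \<open>The trapezoidal and midpoint sums share a limit, so their exact product formula becomes
  a square. The clause on \<open>f\<close> is meant for the involution: such an \<open>f\<close>
  fixes every dyadic average.\<close>

theorem inverse_square_root:
  fixes b :: 'a
  assumes "unit_segment 1 b"
  obtains T where "T * T * b = 1" "\<And>x. b * x = x * b \<Longrightarrow> T * x = x * T"
    "\<And>f. linear f \<Longrightarrow> continuous_on UNIV f \<Longrightarrow> f b = b \<Longrightarrow> f 1 = 1 \<Longrightarrow>
      (\<And>x y. f (x * y) = f y * f x) \<Longrightarrow> f T = T"
proof -
  let ?F = "pencil_inv 1 b"
  obtain K where "compact K" "lipschitz_into K ?F"
    using lipschitz_into_pencil_inv[OF assms] by metis
  then obtain T where T: "dyadic_avg 0 ?F \<longlonglongrightarrow> T" "dyadic_avg (1 / 2) ?F \<longlonglongrightarrow> T"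
    using dyadic_avg_convergent_compact by metis
  have com: "T * x = x * T" if "b * x = x * b" for x
  proof (rule LIMSEQ_unique)
    have "dyadic_avg 0 ?F n * x = x * dyadic_avg 0 ?F n" for n
      using assms that by (intro dyadic_avg_commute pencil_inv_commute) auto
    then show "(\<lambda>n. dyadic_avg 0 ?F n * x) \<longlonglongrightarrow> x * T"
      using tendsto_mult[OF tendsto_const T(1), of x] by simp
    show "(\<lambda>n. dyadic_avg 0 ?F n * x) \<longlonglongrightarrow> T * x"
      by (intro tendsto_mult tendsto_const T)
  qed
  show ?thesis
  proof
    have "(\<lambda>n. 1 * b * dyadic_avg 0 ?F n * dyadic_avg (1 / 2) ?F n) \<longlonglongrightarrow> 1 * b * T * T"
      by (intro tendsto_mult tendsto_const T)
    then have "b * T * T = 1"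
      using trapezoidal_mult_midpoint[OF _ assms] by (simp add: LIMSEQ_const_iff)
    then show "T * T * b = 1"
      using com[of b] by (metis mult.assoc)
    show "T * x = x * T" if "b * x = x * b" for x
      using com[OF that] .
    fix f :: "'a \<Rightarrow> 'a"
    assume f: "linear f" "continuous_on UNIV f" "f b = b" "f 1 = 1"
      "\<And>x y. f (x * y) = f y * f x"
    have "f (unit_inv p) = unit_inv p" if "p \<in> units" "f p = p" for p
      using that f(4,5) units_inv[OF that(1)] unit_inv_eqI by metis
    moreover have "f (pencil 1 b t) = pencil 1 b t" for t
      by (simp add: pencil_def linear_add[OF f(1)] linear_scale[OF f(1)] f)
    ultimately have "f (dyadic_avg 0 ?F n) = dyadic_avg 0 ?F n" for n
      by (simp add: dyadic_avg_def linear_sum[OF f(1)] linear_scale[OF f(1)] pencil_inv_def pencil_in_units[OF assms])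
    moreover have "(\<lambda>n. f (dyadic_avg 0 ?F n)) \<longlonglongrightarrow> f T"
      using f(2) T(1) by (metis UNIV_I continuous_on_eq_continuous_at isCont_tendsto_compose open_UNIV)
    ultimately show "f T = T"
      using T(1) LIMSEQ_unique by simp
  qed
qed

end

section \<open>Powers of elements of spectral radius less than one\<close>

lemma norm_cis_diff_le: "cmod (cis x - cis y) \<le> \<bar>x - y\<bar>"
proof -
  have "cis x - cis y = cis y * (cis (x - y) - 1)"
    by (simp add: right_diff_distrib cis_mult)
  then have "cmod (cis x - cis y) = cmod (cis (x - y) - 1)"
    by (simp add: norm_mult)
  also have "\<dots> = 2 * \<bar>sin ((x - y) / 2)\<bar>"
    using dist_exp_i_1[of "x - y"] by (simp add: cis_conv_exp)
  also have "\<dots> \<le> \<bar>x - y\<bar>"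
    using abs_sin_x_le_abs_x[of "(x - y) / 2"] by simp
  finally show ?thesis .
qed

lemma dyadic_avg_const: "dyadic_avg \<delta> (\<lambda>_. c) n = c"
  by (simp add: dyadic_avg_def scaleR_sum_left[symmetric] sum_constant_scaleR del: sum_constant)

context continuous_inverse_algebra
begin

lemma one_minus_square_in_units:
  assumes "\<And>z. cmod z = 1 \<Longrightarrow> 1 - scaleC z h \<in> units" "cmod z = 1"
  shows "1 - scaleC z (h * h) \<in> units"
proof -
  define w where "w = csqrt z"
  have w: "w * w = z" "cmod w = 1"
    using assms(2) by (simp_all add: w_def flip: power2_eq_square)
  have "1 - scaleC z (h * h) = (1 - scaleC w h) * (1 - scaleC (- w) h)"
    by (simp add: algebra_simps scaleC_mult_scaleC flip: w(1))
  also have "\<dots> \<in> units"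
    using w by (intro units_mult(1) assms(1)) auto
  finally show ?thesis .
qed

text \<open>Partial fraction decomposition of 1 / (1 - h^N), N = 2^n, over the N-th roots of unity.
  Pairing \<zeta> with -\<zeta> replaces \<open>h\<close> by \<open>h * h\<close>, hence the
  induction with \<open>h\<close> arbitrary.\<close>

lemma average_resolvent_roots_of_unity:
  assumes "\<And>z. cmod z = 1 \<Longrightarrow> 1 - scaleC z h \<in> units"
  shows "1 - h ^ 2 ^ n \<in> units"
    "dyadic_avg 0 (\<lambda>x. unit_inv (1 - scaleC (cis (2 * pi * x)) h)) n = unit_inv (1 - h ^ 2 ^ n)"
proof -
  have "1 - h ^ 2 ^ n \<in> units \<and>
    dyadic_avg 0 (\<lambda>x. unit_inv (1 - scaleC (cis (2 * pi * x)) h)) n = unit_inv (1 - h ^ 2 ^ n)"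
    using assms
  proof (induction n arbitrary: h)
    case 0
    then show ?case
      using 0[of 1] by (simp add: dyadic_avg_def)
  next
    case (Suc n)
    let ?R = "\<lambda>h x. unit_inv (1 - scaleC (cis (2 * pi * x)) h)"
    have sq: "1 - scaleC z (h * h) \<in> units" if "cmod z = 1" for z
      using one_minus_square_in_units Suc.prems that by blast
    have "?R h x + ?R h (x + 1 / 2) = 2 *\<^sub>R (1 * ?R (h * h) (2 * x))" for x
    proof -
      define u where "u = scaleC (cis (2 * pi * x)) h"
      have shift: "scaleC (cis (2 * pi * (x + 1 / 2))) h = - u"
        by (simp add: u_def distrib_left flip: cis_mult)
      have double: "scaleC (cis (2 * pi * (2 * x))) (h * h) = u * u"
        by (simp add: u_def scaleC_mult_scaleC cis_mult)
      have units: "1 - u \<in> units" "1 + u \<in> units"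
        using Suc.prems[of "cis (2 * pi * x)"] Suc.prems[of "- cis (2 * pi * x)"] by (simp_all add: u_def)
      have "unit_inv (1 - u) + unit_inv (1 + u) = ((1 - u) + (1 + u)) * unit_inv ((1 - u) * (1 + u))"
        using units by (intro unit_inv_add) (simp_all add: algebra_simps)
      also have "(1 - u) + (1 + u) = 2 *\<^sub>R 1"
        by (simp add: scaleR_2)
      also have "(1 - u) * (1 + u) = 1 - u * u"
        by (simp add: algebra_simps)
      finally show ?thesis
        unfolding shift double by (simp add: u_def)
    qed
    then have "dyadic_avg 0 (?R h) (Suc n) = dyadic_avg 0 (?R (h * h)) n"
      using dyadic_avg_doubling[of "?R h" 1 "?R (h * h)" 0 n] by simp
    moreover have "h ^ 2 ^ Suc n = (h * h) ^ 2 ^ n"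
      by (simp add: power_mult power2_eq_square)
    ultimately show ?case
      using Suc.IH[of "h * h"] sq by simp
  qed
  then show "1 - h ^ 2 ^ n \<in> units"
    "dyadic_avg 0 (\<lambda>x. unit_inv (1 - scaleC (cis (2 * pi * x)) h)) n = unit_inv (1 - h ^ 2 ^ n)"
    by blast+
qed

lemma idempotent_unit_eq_one: "L * L = L \<Longrightarrow> L \<in> units \<Longrightarrow> L = 1"
  by (metis mult.assoc mult_1_left units_inv(2))

text \<open>The resolvent identity, uniformly on the closed disc. The constant 8 exceeds 2 \<pi>,
  the Lipschitz constant of \<open>cis (2 * pi * x)\<close> in x.\<close>

lemma resolvent_diff_compact:
  assumes "\<And>z. cmod z \<le> 1 \<Longrightarrow> 1 - scaleC z h \<in> units"
  obtains K where "compact K"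
    "\<And>z w d. cmod z \<le> 1 \<Longrightarrow> cmod w \<le> 1 \<Longrightarrow> cmod (z - w) \<le> 8 * d \<Longrightarrow>
      unit_inv (1 - scaleC z h) - unit_inv (1 - scaleC w h) \<in> (*\<^sub>R) d ` K"
proof
  let ?f = "\<lambda>p :: complex \<times> complex \<times> complex. scaleC (fst p)
    (unit_inv (1 - scaleC (fst (snd p)) h) * h * unit_inv (1 - scaleC (snd (snd p)) h))"
  let ?S = "cball 0 8 \<times> cball 0 1 \<times> cball 0 1"
  let ?K = "?f ` ?S"
  have "continuous_on ?S ?f"
    by (intro continuous_intros assms) auto
  then show "compact ?K"
    by (intro compact_continuous_image compact_Times) auto
  fix z w :: complex and d :: real
  assume zw: "cmod z \<le> 1" "cmod w \<le> 1" "cmod (z - w) \<le> 8 * d"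
  have d: "0 \<le> d"
    using zw(3) norm_ge_zero[of "z - w"] by linarith
  \<comment> \<open>If d = 0 then z = w, and the default value 0 of the quotient is the right
    one.\<close>
  define \<zeta> where "\<zeta> = (z - w) / of_real d"
  have \<zeta>: "of_real d * \<zeta> = z - w" "cmod \<zeta> \<le> 8"
    using zw(3) d by (auto simp: \<zeta>_def norm_divide divide_le_eq)
  have "unit_inv (1 - scaleC z h) - unit_inv (1 - scaleC w h) =
      unit_inv (1 - scaleC z h) * ((1 - scaleC w h) - (1 - scaleC z h)) * unit_inv (1 - scaleC w h)"
    using assms zw by (intro unit_inv_diff) auto
  also have "(1 - scaleC w h) - (1 - scaleC z h) = scaleC (of_real d * \<zeta>) h"
    unfolding \<zeta> by (simp add: scaleC.scale_left_diff_distrib)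
  also have "unit_inv (1 - scaleC z h) * scaleC (of_real d * \<zeta>) h * unit_inv (1 - scaleC w h) =
      d *\<^sub>R ?f (\<zeta>, z, w)"
    by (simp add: mult_scaleC_left mult_scaleC_right flip: scaleC_of_real)
  finally show "unit_inv (1 - scaleC z h) - unit_inv (1 - scaleC w h) \<in> (*\<^sub>R) d ` ?K"
    using zw \<zeta> by (intro image_eqI[of _ _ "?f (\<zeta>, z, w)"] imageI) auto
qed

end

context mackey_complete_cia
begin

text \<open>For x = h^(2^n) and D n the inverse of 1 - x, the inverse of 1 + x is 2 D (n+1) - D n.
  Hence D (n+1) = D n (2 D (n+1) - D n), which in the limit says L = L L.\<close>

lemma resolvent_of_powers_convergent:
  assumes h: "\<And>z. cmod z \<le> 1 \<Longrightarrow> 1 - scaleC z h \<in> units"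
  obtains L where "(\<lambda>n. unit_inv (1 - h ^ 2 ^ n)) \<longlonglongrightarrow> L" "L * L = L"
proof -
  let ?F = "\<lambda>x. unit_inv (1 - scaleC (cis (2 * pi * x)) h)"
  let ?D = "\<lambda>n. unit_inv (1 - h ^ 2 ^ n)"
  have D: "dyadic_avg 0 ?F n = ?D n" "1 - h ^ 2 ^ n \<in> units" for n
    using average_resolvent_roots_of_unity[of h n] h by auto
  obtain K where K: "compact K"
    "\<And>z w d. cmod z \<le> 1 \<Longrightarrow> cmod w \<le> 1 \<Longrightarrow> cmod (z - w) \<le> 8 * d \<Longrightarrow>
      unit_inv (1 - scaleC z h) - unit_inv (1 - scaleC w h) \<in> (*\<^sub>R) d ` K"
    using resolvent_diff_compact[OF h] by metis
  have "lipschitz_into K ?F"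
    unfolding lipschitz_into_def
  proof (intro ballI K(2))
    fix x y :: real
    have "cmod (cis (2 * pi * x) - cis (2 * pi * y)) \<le> \<bar>2 * pi * x - 2 * pi * y\<bar>"
      by (rule norm_cis_diff_le)
    also have "2 * pi * x - 2 * pi * y = 2 * pi * (x - y)"
      by (rule right_diff_distrib[symmetric])
    also have "\<bar>\<dots>\<bar> = 2 * pi * \<bar>x - y\<bar>"
      by (simp add: abs_mult)
    also have "\<dots> \<le> 8 * \<bar>x - y\<bar>"
      using pi_less_4 by (intro mult_right_mono) auto
    finally show "cmod (cis (2 * pi * x) - cis (2 * pi * y)) \<le> 8 * \<bar>x - y\<bar>" .
  qed auto
  then obtain L where "dyadic_avg 0 ?F \<longlonglongrightarrow> L"
    using dyadic_avg_convergent_compact[OF K(1)] by metis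
  moreover have "dyadic_avg 0 ?F = ?D"
    by (rule ext) (rule D(1))
  ultimately have L: "?D \<longlonglongrightarrow> L"
    by simp
  have D_Suc: "?D (Suc n) = ?D n * (2 *\<^sub>R ?D (Suc n) - ?D n)" for n
  proof -
    define x where "x = h ^ 2 ^ n"
    have x: "h ^ 2 ^ Suc n = x * x"
      by (simp add: x_def mult_2 power_add)
    have *: "(1 - x) * (1 + x) = 1 - x * x" "(1 + x) * (1 - x) = 1 - x * x"
      by (simp_all add: algebra_simps)
    have units: "1 - x \<in> units" "1 + x \<in> units"
      using D(2)[of n] D(2)[of "Suc n"] units_cancel_left[of "1 - x" "1 + x"]
      by (simp_all only: x x_def[symmetric] *)
    have sum: "unit_inv (1 - x) + unit_inv (1 + x) = 2 *\<^sub>R unit_inv (1 - x * x)"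
    proof -
      have "unit_inv (1 - x) + unit_inv (1 + x) = ((1 - x) + (1 + x)) * unit_inv ((1 - x) * (1 + x))"
        using units * by (intro unit_inv_add) simp_all
      also have "(1 - x) + (1 + x) = 2 *\<^sub>R 1"
        by (simp add: scaleR_2)
      finally show ?thesis
        by (simp add: *)
    qed
    have "unit_inv (1 - x * x) = unit_inv (1 - x) * unit_inv (1 + x)"
      using units_mult(2)[OF units(2,1)] by (simp add: *)
    also have "unit_inv (1 + x) = 2 *\<^sub>R unit_inv (1 - x * x) - unit_inv (1 - x)"
      using sum by (simp add: algebra_simps)
    finally show ?thesis
      by (simp only: x x_def[symmetric])
  qed
  have "(\<lambda>n. ?D n * (2 *\<^sub>R ?D (Suc n) - ?D n)) \<longlonglongrightarrow> L * (2 *\<^sub>R L - L)"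
    by (intro tendsto_mult tendsto_diff tendsto_scaleR_const LIMSEQ_Suc[OF L] L)
  then have "(\<lambda>n. ?D (Suc n)) \<longlonglongrightarrow> L * (2 *\<^sub>R L - L)"
    unfolding D_Suc[symmetric] .
  then have "L = L * (2 *\<^sub>R L - L)"
    by (rule LIMSEQ_unique[OF LIMSEQ_Suc[OF L]])
  then have "L * L = L"
    by (simp add: scaleR_2)
  with L that show ?thesis
    by blast
qed

text \<open>The limit of \<open>(1 - (t h)\<^bsup>N\<^esup>)\<^sup>-\<^sup>1\<close> is an idempotent depending continuously on \<open>t \<in> [0, 1]\<close>.
  As it is \<open>1\<close> for \<open>t = 0\<close>, it remains a unit in small steps of \<open>t\<close>, hence equals \<open>1\<close>.\<close>

theorem powers_tendsto_zero:
  assumes h: "\<And>z. cmod z \<le> 1 \<Longrightarrow> 1 - scaleC z h \<in> units"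
  shows "(\<lambda>n. h ^ 2 ^ n) \<longlonglongrightarrow> 0"
proof -
  let ?D = "\<lambda>t n. unit_inv (1 - (t *\<^sub>R h) ^ 2 ^ n)"
  let ?F = "\<lambda>t x. unit_inv (1 - scaleC (of_real t * cis (2 * pi * x)) h)"
  have th: "1 - scaleC z (t *\<^sub>R h) \<in> units" if "cmod z \<le> 1" "t \<in> {0..1}" for z t
    using h[of "z * of_real t"] that mult_mono[of "cmod z" 1 t 1]
    by (simp add: norm_mult flip: scaleC_of_real)
  have D: "?D t n = dyadic_avg 0 (?F t) n" if "t \<in> {0..1}" for t n
    using average_resolvent_roots_of_unity(2)[of "t *\<^sub>R h" n] th[OF _ that]
    by (simp add: mult.commute flip: scaleC_of_real)
  have "\<exists>L. ?D t \<longlonglongrightarrow> L \<and> L * L = L" if "t \<in> {0..1}" for t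
    using resolvent_of_powers_convergent[of "t *\<^sub>R h"] th[OF _ that] by metis
  then obtain L where L: "\<And>t. t \<in> {0..1} \<Longrightarrow> ?D t \<longlonglongrightarrow> L t" "\<And>t. t \<in> {0..1} \<Longrightarrow> L t * L t = L t"
    by metis
  obtain K where K: "compact K"
    "\<And>z w d. cmod z \<le> 1 \<Longrightarrow> cmod w \<le> 1 \<Longrightarrow> cmod (z - w) \<le> 8 * d \<Longrightarrow>
      unit_inv (1 - scaleC z h) - unit_inv (1 - scaleC w h) \<in> (*\<^sub>R) d ` K"
    using resolvent_diff_compact[OF h] by metis
  obtain B where B: "convex B" "tvs_bounded B" "K \<subseteq> B" "0 \<in> B"
    using compact_subset_disc[OF K(1)] by metis
  \<comment> \<open>The factor 2 is there because (L t - L s) / 2 will arise in \<open>step\<close>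
    as the midpoint of two elements of V.\<close>
  let ?U = "(\<lambda>x :: 'a. 1 + 2 *\<^sub>R x) -` units"
  have "open ?U" "0 \<in> ?U"
    using open_units one_in_units by (auto intro!: open_vimage continuous_intros)
  then obtain V where V: "open V" "convex V" "0 \<in> V" "V \<subseteq> ?U"
    using locally_convex by blast
  obtain r where r: "r > 0" "B \<subseteq> (*\<^sub>R) r ` V"
    using B V by (auto simp: tvs_bounded_def)
  \<comment> \<open>The bound does not depend on n and so controls the limits as well.\<close>
  have close: "?D t n - ?D s n \<in> V" if "s \<in> {0..1}" "t \<in> {0..1}" "\<bar>t - s\<bar> \<le> inverse r" for s t n
  proof -
    have "?F t x - ?F s x \<in> (*\<^sub>R) \<bar>t - s\<bar> ` B" for x
    proof -
      have "cmod (of_real t * cis (2 * pi * x) - of_real s * cis (2 * pi * x)) = \<bar>t - s\<bar>"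
        by (simp add: norm_mult flip: left_diff_distrib of_real_diff)
      then have "?F t x - ?F s x \<in> (*\<^sub>R) \<bar>t - s\<bar> ` K"
        using that by (intro K(2)) (auto simp: norm_mult)
      then show ?thesis
        using B(3) by blast
    qed
    then have "dyadic_avg 0 (?F t) n - dyadic_avg 0 (?F s) n \<in> (*\<^sub>R) \<bar>t - s\<bar> ` B"
      using B(1) by (intro dyadic_avg_diff_mem convex_scaling) (simp_all only: add_0_right)
    also have "\<dots> \<subseteq> (*\<^sub>R) (\<bar>t - s\<bar> * r) ` V"
      using image_mono[OF r(2), of "(*\<^sub>R) \<bar>t - s\<bar>"] by (simp add: image_image)
    also have "\<dots> \<subseteq> (*\<^sub>R) 1 ` V"
      using that(3) r V by (intro scaleR_image_mono) (auto simp: field_simps)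
    finally show ?thesis
      using that by (simp add: D)
  qed
  have step: "L t = 1" if "s \<in> {0..1}" "t \<in> {0..1}" "\<bar>t - s\<bar> \<le> inverse r" "L s = 1" for s t
  proof -
    have "(\<lambda>n. (L t - L s) - (?D t n - ?D s n)) \<longlonglongrightarrow> (L t - L s) - (L t - L s)"
      using that by (intro tendsto_diff tendsto_const L)
    then have "\<forall>\<^sub>F n in sequentially. (L t - L s) - (?D t n - ?D s n) \<in> V"
      using V by (intro topological_tendstoD) auto
    then obtain n where n: "(L t - L s) - (?D t n - ?D s n) \<in> V"
      by (auto simp: eventually_sequentially)
    have "(1 / 2) *\<^sub>R ((L t - L s) - (?D t n - ?D s n)) + (1 / 2) *\<^sub>R (?D t n - ?D s n) \<in> V"
      using n close[OF that(1-3), of n] V by (intro convexD) auto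
    then have "(1 / 2) *\<^sub>R (L t - L s) \<in> V"
      by (simp flip: scaleR_right_distrib)
    then have "L t \<in> units"
      using V(4) that(4) by auto
    then show ?thesis
      using idempotent_unit_eq_one L(2) that by blast
  qed
  obtain N :: nat where N: "r < real N"
    using reals_Archimedean2 by blast
  have "L (real j / real N) = 1" if "j \<le> N" for j
    using that
  proof (induction j)
    case 0
    have "?D 0 n = 1" for n
      using D[of 0 n] by (simp add: dyadic_avg_const unit_inv_one)
    then show ?case
      using L(1)[of 0] by (simp add: LIMSEQ_const_iff)
  next
    case (Suc j)
    have "real (Suc j) / real N - real j / real N = inverse (real N)"
      by (simp add: add_divide_distrib inverse_eq_divide)
    moreover have "inverse (real N) \<le> inverse r"
      using N r by (intro le_imp_inverse_le) auto
    ultimately show ?case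
      using Suc N r by - (rule step[of "real j / real N"], simp_all)
  qed
  from this[of N] have "L 1 = 1"
    using N r by auto
  then have "?D 1 \<longlonglongrightarrow> 1"
    using L(1)[of 1] by simp
  \<comment> \<open>Continuity of inversion at 1 turns convergence of the inverses into convergence
    of 1 - h^(2^n).\<close>
  then have "(\<lambda>n. unit_inv (?D 1 n)) \<longlonglongrightarrow> unit_inv 1"
    using one_in_units by (rule tendsto_unit_inv)
  moreover have "unit_inv (?D 1 n) = 1 - h ^ 2 ^ n" for n
    using average_resolvent_roots_of_unity(1)[of h n] h by (simp add: unit_inv_inv)
  ultimately have "(\<lambda>n. 1 - h ^ 2 ^ n) \<longlonglongrightarrow> 1"
    by (simp add: unit_inv_one)
  from tendsto_diff[OF tendsto_const[of 1] this] show ?thesis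
    by simp
qed

end

section \<open>Positive elements of hermitian algebras\<close>

locale hermitian_cia = mackey_complete_cia scaleC
  for scaleC :: "complex \<Rightarrow> 'a \<Rightarrow>
    'a::{real_algebra, monoid_mult, t2_space, topological_ab_group_add, topological_semigroup_mult}" +
  fixes star :: "'a \<Rightarrow> 'a"
  assumes involution: "algebra_involution scaleC star"
    and continuous_star: "continuous_on UNIV star"
    and hermitian: "hermitian scaleC star"
begin

lemma star_add: "star (x + y) = star x + star y"
  and star_scaleC: "star (scaleC c x) = scaleC (cnj c) (star x)"
  and star_mult: "star (x * y) = star y * star x"
  and star_star: "star (star x) = x"
  using involution by (auto simp: algebra_involution_def)

lemma star_scaleR: "star (r *\<^sub>R x) = r *\<^sub>R star x"
  using star_scaleC[of "of_real r" x] by (simp add: scaleC_of_real)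

lemma linear_star: "linear star"
  by (intro linearI star_add star_scaleR)

lemma star_diff: "star (x - y) = star x - star y"
  and star_minus: "star (- x) = - star x"
  by (simp_all add: linear_diff[OF linear_star] linear_neg[OF linear_star])

lemma star_one: "star 1 = 1"
  by (metis mult_1_right star_mult star_star)

lemmas star_simps = star_add star_diff star_minus star_scaleC star_scaleR star_mult star_star star_one

lemma star_power: "star (x ^ n) = star x ^ n"
  by (induction n) (simp_all add: star_simps power_commutes)

lemma star_unit_inv:
  assumes "x \<in> units"
  shows "star x \<in> units" "star (unit_inv x) = unit_inv (star x)"
proof -
  have "star x * star (unit_inv x) = 1" "star (unit_inv x) * star x = 1"
    using units_inv[OF assms] by (metis star_mult star_one)+
  then show "star x \<in> units" "star (unit_inv x) = unit_inv (star x)"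
    using unitsI unit_inv_eqI by metis+
qed

lemma one_plus_nonreal_in_units:
  assumes "star x = x" "Im c \<noteq> 0"
  shows "1 + scaleC c x \<in> units"
proof -
  have c: "c \<noteq> 0"
    using assms(2) by auto
  have "Im (- inverse c) \<noteq> 0"
    using assms(2) c by (simp add: complex_eq_iff)
  then have "- inverse c \<notin> \<real>"
    using complex_is_Real_iff by blast
  then have "scaleC (- inverse c) 1 - x \<in> units"
    using hermitian assms(1) unfolding hermitian_def spectrum_def by (metis (mono_tags, lifting) mem_Collect_eq subsetD)
  then have "scaleC (- c) (scaleC (- inverse c) 1 - x) \<in> units"
    using units_scaleC_iff[of "- c" "scaleC (- inverse c) 1 - x"] c by (metis neg_equal_0_iff_equal)
  then show ?thesis
    using c by (simp add: scaleC.scale_right_diff_distrib)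
qed

lemma one_plus_imaginary_in_units:
  assumes "star x = x"
  shows "1 + scaleC (\<i> * of_real r) x \<in> units"
  using one_plus_nonreal_in_units[OF assms, of "\<i> * of_real r"] one_in_units by (cases "r = 0") auto

lemma hermitian_inverse_square_root:
  assumes "star b = b" "unit_segment 1 b"
  obtains T where "star T = T" "T \<in> units" "T * T * b = 1" "T * b * T = 1"
    "\<And>x. b * x = x * b \<Longrightarrow> T * x = x * T"
proof -
  obtain T where T: "T * T * b = 1" "\<And>x. b * x = x * b \<Longrightarrow> T * x = x * T" "star T = T"
    using inverse_square_root[OF assms(2)] assms(1) linear_star continuous_star star_one star_mult by metis
  have "T * b = b * T"
    using T(2)[of b] by simp
  then have eq: "T * (T * b) = 1" "(T * b) * T = 1"
    using T(1) by (metis mult.assoc)+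
  with that T unitsI[OF eq] show ?thesis
    by metis
qed

text \<open>Nonnegative spectrum: for t > 0, -1/t is a spectral value exactly when 1 + t h fails to
  be a unit.\<close>

definition positive :: "'a \<Rightarrow> bool" where
  "positive h \<longleftrightarrow> star h = h \<and> (\<forall>t\<ge>0. 1 + t *\<^sub>R h \<in> units)"

lemma positive_scaleR: "positive h \<Longrightarrow> c \<ge> 0 \<Longrightarrow> positive (c *\<^sub>R h)"
  by (simp add: positive_def star_simps)

lemma positive_square:
  assumes "star h = h"
  shows "positive (h * h)"
  unfolding positive_def
proof (intro conjI allI impI)
  fix t :: real assume "t \<ge> 0"
  then have "\<i> * of_real (sqrt t) * (\<i> * of_real (- sqrt t)) = of_real t"
    by (simp add: complex_eq_iff)
  then have "(1 + scaleC (\<i> * of_real (sqrt t)) h) * (1 + scaleC (\<i> * of_real (- sqrt t)) h) = 1 + t *\<^sub>R (h * h)"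
    by (simp only: distrib_left distrib_right scaleC_mult_scaleC scaleC_of_real) (simp add: add.assoc)
  then show "1 + t *\<^sub>R (h * h) \<in> units"
    using units_mult(1) one_plus_imaginary_in_units[OF assms] by metis
qed (simp add: star_simps assms)

text \<open>With \<open>T\<^sup>2 = (1 - a\<^sup>* a)\<^sup>-\<^sup>1\<close>, conjugation by \<open>T\<close> turns
  \<open>(1 + a\<^sup>*) (1 - a) = (1 - a\<^sup>* a) + (a\<^sup>* - a)\<close> into \<open>1\<close> plus a skew-hermitian element.\<close>

lemma one_plus_star_mult_one_minus_in_units:
  assumes "\<And>t. t \<in> {0..1} \<Longrightarrow> 1 - t *\<^sub>R (star a * a) \<in> units"
  shows "(1 + star a) * (1 - a) \<in> units"
proof -
  define b where "b = 1 - star a * a"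
  have "unit_segment 1 b"
    using assms by (simp add: unit_segment_def b_def algebra_simps)
  moreover have "star b = b"
    by (simp add: b_def star_simps)
  ultimately obtain T where T: "star T = T" "T \<in> units" "T * b * T = 1"
    using hermitian_inverse_square_root by metis
  define k where "k = scaleC (- \<i>) (T * (star a - a) * T)"
  have "star k = k"
    by (simp add: k_def star_simps T(1) mult.assoc right_diff_distrib left_diff_distrib
        scaleC.scale_right_diff_distrib)
  then have "1 + scaleC \<i> k \<in> units"
    using one_plus_imaginary_in_units[of k 1] by simp
  moreover have "1 + scaleC \<i> k = T * b * T + T * (star a - a) * T"
    by (simp add: k_def T(3))
  moreover have "\<dots> = T * (((1 + star a) * (1 - a)) * T)"
    by (simp add: b_def algebra_simps)
  ultimately show ?thesis
    using T(2) units_cancel_left units_cancel_right by metis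
qed

text \<open>A form of Ptak's inequality between the spectral radii of \<open>a\<close> and
  \<open>star a * a\<close>. The products of \<open>1 + star a\<close> and \<open>1 - a\<close> in
  both orders are units; the second order is the first one applied to
  \<open>- star a\<close>.\<close>

lemma one_minus_in_units:
  assumes "\<And>t. t \<in> {0..1} \<Longrightarrow> 1 - t *\<^sub>R (star a * a) \<in> units"
  shows "1 - a \<in> units"
proof (rule units_of_both_products)
  show "(1 + star a) * (1 - a) \<in> units"
    using assms by (rule one_plus_star_mult_one_minus_in_units)
  have "1 - t *\<^sub>R (a * star a) \<in> units" if "t \<in> {0..1}" for t
    using one_minus_mult_swap[of "t *\<^sub>R star a" a] assms[OF that] by simp
  then have "(1 + star (- star a)) * (1 - (- star a)) \<in> units"
    by (intro one_plus_star_mult_one_minus_in_units) (simp add: star_simps)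
  then show "(1 - a) * (1 + star a) \<in> units"
    by (simp add: star_simps)
qed

text \<open>The spectral radius is submultiplicative on hermitian elements: the condition on
  \<open>h\<^sup>2 k\<^sup>2\<close> controls \<open>h k\<close>, because \<open>(h k)\<^sup>* (h k) = k h\<^sup>2 k\<close>.\<close>

lemma one_minus_product_in_units:
  assumes "star h = h" "star k = k" "(\<lambda>n. h ^ 2 ^ n) \<longlonglongrightarrow> 0" "(\<lambda>n. k ^ 2 ^ n) \<longlonglongrightarrow> 0"
  shows "1 - h * k \<in> units"
proof -
  \<comment> \<open>The starred square of H K is K H H K, and cyclic permutation of the factors
    relates its unit condition to that of H H K K.\<close>
  have down: "1 - t *\<^sub>R (H * K) \<in> units"
    if "star H = H" "star K = K" "\<And>t. t \<in> {0..1} \<Longrightarrow> 1 - t *\<^sub>R (H * H * (K * K)) \<in> units" "t \<in> {0..1}" for H K t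
  proof (rule one_minus_in_units)
    fix s :: real assume s: "s \<in> {0..1}"
    have "s * (t * t) \<in> {0..1}"
      using s that(4) by (auto intro!: mult_nonneg_nonneg mult_le_one)
    then have "1 - (H * H * K) * ((s * (t * t)) *\<^sub>R K) \<in> units"
      using that(3)[of "s * (t * t)"] by (simp add: mult.assoc)
    then have "1 - ((s * (t * t)) *\<^sub>R K) * (H * H * K) \<in> units"
      by (rule one_minus_mult_swap)
    then show "1 - s *\<^sub>R (star (t *\<^sub>R (H * K)) * (t *\<^sub>R (H * K))) \<in> units"
      by (simp add: star_simps that(1,2) mult.assoc)
  qed
  have "open ((\<lambda>x :: 'a. 1 - x) -` units)" "0 \<in> (\<lambda>x :: 'a. 1 - x) -` units"
    using open_units one_in_units by (auto intro!: open_vimage continuous_intros)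
  then obtain V where V: "open V" "convex V" "0 \<in> V" "V \<subseteq> (\<lambda>x :: 'a. 1 - x) -` units"
    using locally_convex by blast
  have "(\<lambda>n. h ^ 2 ^ n * k ^ 2 ^ n) \<longlonglongrightarrow> 0 * 0"
    by (intro tendsto_mult assms)
  then have "\<forall>\<^sub>F n in sequentially. h ^ 2 ^ n * k ^ 2 ^ n \<in> V"
    using V by (intro topological_tendstoD) auto
  then obtain N where N: "h ^ 2 ^ N * k ^ 2 ^ N \<in> V"
    by (auto simp: eventually_sequentially)
  have start: "1 - t *\<^sub>R (h ^ 2 ^ N * k ^ 2 ^ N) \<in> units" if "t \<in> {0..1}" for t
  proof -
    have "t *\<^sub>R (h ^ 2 ^ N * k ^ 2 ^ N) + (1 - t) *\<^sub>R 0 \<in> V"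
      using N V that by (intro convexD) auto
    then show ?thesis
      using V by auto
  qed
  have "1 - t *\<^sub>R (h ^ 2 ^ (N - j) * k ^ 2 ^ (N - j)) \<in> units" if "j \<le> N" "t \<in> {0..1}" for j t
    using that
  proof (induction j arbitrary: t)
    case (Suc j)
    have eq: "x ^ 2 ^ (N - j) = x ^ 2 ^ (N - Suc j) * x ^ 2 ^ (N - Suc j)" for x :: 'a
    proof -
      have "(2 :: nat) ^ (N - j) = 2 ^ (N - Suc j) + 2 ^ (N - Suc j)"
        using Suc.prems(1) by (metis Suc_diff_le Suc_le_eq diff_Suc_Suc mult_2 power_Suc)
      then show ?thesis
        by (simp only: power_add)
    qed
    show ?case
    proof (rule down)
      fix s :: real assume "s \<in> {0..1}"
      with Suc.IH[of s] Suc.prems(1) have "1 - s *\<^sub>R (h ^ 2 ^ (N - j) * k ^ 2 ^ (N - j)) \<in> units"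
        by (metis Suc_leD)
      then show "1 - s *\<^sub>R (h ^ 2 ^ (N - Suc j) * h ^ 2 ^ (N - Suc j) *
          (k ^ 2 ^ (N - Suc j) * k ^ 2 ^ (N - Suc j))) \<in> units"
        by (simp only: eq)
    qed (use Suc.prems in \<open>simp_all add: star_power assms\<close>)
  qed (use start in simp)
  from this[of N 1] show ?thesis
    by simp
qed

text \<open>Here c = h / (1 + h), which maps the nonnegative reals into [0, 1). Accordingly 1 - z c
  = (1 + (1 - z) h) / (1 + h) is a unit for |z| \<le> 1, by positivity for real z and by hermiticity
  otherwise.\<close>

lemma positive_cayley:
  assumes "positive h"
  defines "c \<equiv> 1 - unit_inv (1 + h)"
  shows "star c = c" "c * (1 + h) = h" "(1 + h) * c = h" "(\<lambda>n. c ^ 2 ^ n) \<longlonglongrightarrow> 0"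
proof -
  have u: "1 + h \<in> units" and h: "star h = h"
    using assms by (auto simp: positive_def dest: spec[of _ "1 :: real"])
  show "star c = c"
    by (simp add: c_def star_simps star_unit_inv[OF u] h)
  show c: "c * (1 + h) = h" "(1 + h) * c = h"
    using units_inv[OF u] by (simp_all add: c_def left_diff_distrib right_diff_distrib)
  show "(\<lambda>n. c ^ 2 ^ n) \<longlonglongrightarrow> 0"
  proof (rule powers_tendsto_zero)
    fix z :: complex assume z: "cmod z \<le> 1"
    have "1 + scaleC (1 - z) h \<in> units"
    proof (cases "Im z = 0")
      case True
      then have "1 - z = of_real (1 - Re z)"
        by (simp add: complex_eq_iff)
      moreover have "Re z \<le> 1"
        using z complex_Re_le_cmod order_trans by blast
      ultimately show ?thesis
        using assms(1) by (simp only: scaleC_of_real positive_def)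
    qed (use one_plus_nonreal_in_units[OF h, of "1 - z"] in simp)
    also have "1 + scaleC (1 - z) h = (1 - scaleC z c) * (1 + h)"
      by (simp only: left_diff_distrib mult_scaleC_left c(1)) (simp add: scaleC.scale_left_diff_distrib)
    finally show "1 - scaleC z c \<in> units"
      using u by (rule units_cancel_right)
  qed
qed

text \<open>With c = h / (1 + h) and d = k / (1 + k), the product (1 + h) (1 - c d) (1 + k) equals
  (1 + h) (1 + k) - h k = 1 + h + k.\<close>

lemma positive_add:
  assumes "positive h" "positive k"
  shows "positive (h + k)"
proof -
  have *: "1 + h + k \<in> units" if hk: "positive h" "positive k" for h k
  proof -
    define c d where "c = 1 - unit_inv (1 + h)" and "d = 1 - unit_inv (1 + k)"
    note c = positive_cayley[OF hk(1), folded c_def] and d = positive_cayley[OF hk(2), folded d_def]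
    have "1 + h \<in> units" "1 + k \<in> units"
      using hk by (auto simp: positive_def dest: spec[of _ "1 :: real"])
    moreover have "1 - c * d \<in> units"
      using c d by (intro one_minus_product_in_units)
    ultimately have "(1 + h) * (1 - c * d) * (1 + k) \<in> units"
      by (intro units_mult(1))
    also have "(1 + h) * (1 - c * d) * (1 + k) = (1 + h) * (1 + k) - ((1 + h) * c) * (d * (1 + k))"
      by (simp only: left_diff_distrib right_diff_distrib mult_1_right mult.assoc)
    also have "\<dots> = 1 + h + k"
      by (simp only: c d) (simp add: algebra_simps)
    finally show ?thesis .
  qed
  show ?thesis
    unfolding positive_def
  proof (intro conjI allI impI)
    fix t :: real assume "t \<ge> 0"
    then show "1 + t *\<^sub>R (h + k) \<in> units"
      using *[of "t *\<^sub>R h" "t *\<^sub>R k"] assms by (simp add: positive_scaleR scaleR_right_distrib add.assoc)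
  qed (use assms in \<open>simp add: positive_def star_simps\<close>)
qed

text \<open>1 + t (1 - x) is a nonzero multiple of 1 - s x with s = t / (1 + t), where the two
  factors of x can be swapped.\<close>

lemma positive_one_minus_swap:
  assumes "positive (1 - star y * y)"
  shows "positive (1 - y * star y)"
  unfolding positive_def
proof (intro conjI allI impI)
  fix t :: real assume t: "t \<ge> 0"
  have eq: "1 + t *\<^sub>R (1 - x) = (1 + t) *\<^sub>R (1 - (t / (1 + t)) *\<^sub>R x)" for x :: 'a
    using t by (simp add: scaleR_right_diff_distrib scaleR_add_left)
  have iff: "1 + t *\<^sub>R (1 - x) \<in> units \<longleftrightarrow> 1 - (t / (1 + t)) *\<^sub>R x \<in> units" for x :: 'a
    using t units_scaleR_iff by (simp only: eq)
  have "1 + t *\<^sub>R (1 - star y * y) \<in> units"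
    using assms t unfolding positive_def by blast
  then have "1 - ((t / (1 + t)) *\<^sub>R star y) * y \<in> units"
    unfolding iff by simp
  then have "1 - y * ((t / (1 + t)) *\<^sub>R star y) \<in> units"
    by (rule one_minus_mult_swap)
  then show "1 + t *\<^sub>R (1 - y * star y) \<in> units"
    by (simp add: iff)
qed (simp add: star_simps)

text \<open>Cartesian decomposition: with p and q twice the real and imaginary part of
  \<open>y\<close>, the sum is (p^2 + q^2) / 2.\<close>

lemma positive_star_mult_add:
  "positive (star y * y + y * star y)"
proof -
  define p q where "p = y + star y" and "q = scaleC (- \<i>) (y - star y)"
  have "star p = p" "star q = q"
    by (simp_all add: p_def q_def star_simps add.commute scaleC.scale_right_diff_distrib)
  then have "positive ((1 / 2) *\<^sub>R (p * p + q * q))"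
    by (intro positive_scaleR positive_add positive_square) auto
  also have "q * q = - ((y - star y) * (y - star y))"
    by (simp add: q_def scaleC_mult_scaleC)
  also have "p * p + - ((y - star y) * (y - star y)) = 2 *\<^sub>R (star y * y + y * star y)"
    by (simp add: p_def algebra_simps scaleR_2)
  finally show ?thesis
    by simp
qed

text \<open>For \<open>h = a\<^sup>* a\<close> and \<open>y = 2 a (1 + h)\<^sup>-\<^sup>1\<close> one has \<open>y\<^sup>* y = 1 - w\<^sup>2\<close> with
  \<open>w = (1 - h) (1 + h)\<^sup>-\<^sup>1\<close>. Hence \<open>1 - y y\<^sup>*\<close> is positive, and adding \<open>y\<^sup>* y + y y\<^sup>*\<close> shows
  that \<open>2 - w\<^sup>2\<close> is positive, which pushes the spectrum of \<open>h\<close> further to the right.\<close>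

lemma one_plus_star_mult_extend:
  assumes seg: "\<And>t. t \<in> {0..1} \<Longrightarrow> 1 + t *\<^sub>R (star a * a) \<in> units" and t: "t \<in> {0..3}"
  shows "1 + t *\<^sub>R (star a * a) \<in> units"
proof (cases "t \<le> 1")
  case False
  define h where "h = star a * a"
  define v where "v = 2 *\<^sub>R unit_inv (1 + h)"
  define y w where "y = a * v" and "w = v - 1"
  have u: "1 + h \<in> units" and h: "star h = h"
    using seg[of 1] by (simp_all add: h_def star_simps)
  have v: "(1 + h) * v = 2 *\<^sub>R 1" "v * (1 + h) = 2 *\<^sub>R 1" and sv: "star v = v"
    using units_inv[OF u] by (simp_all add: v_def star_simps star_unit_inv[OF u] h)
  have sw: "star w = w"
    by (simp add: w_def star_simps sv)
  have "h * v = 2 *\<^sub>R 1 - v"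
    using v(1) by (simp add: algebra_simps)
  then have "star y * y = v * (2 *\<^sub>R 1 - v)"
    by (simp add: y_def star_simps sv h_def mult.assoc)
  then have yy: "star y * y = 1 - w * w"
    by (simp add: w_def algebra_simps scaleR_2)
  then have "positive (1 - star y * y)"
    using positive_square[OF sw] by simp
  then have "positive ((star y * y + y * star y) + (1 - y * star y))"
    by (intro positive_add positive_star_mult_add positive_one_minus_swap)
  then have pos: "positive (2 *\<^sub>R 1 - w * w)"
    by (simp add: yy scaleR_2 algebra_simps)
  \<comment> \<open>The map h \<mapsto> w = (1 - h) / (1 + h) sends -1/t to c, so the question is
    whether c - w is a unit. The range t \<le> 3 gives c \<ge> 2, hence c^2 > 2, which clears the
    bound on w^2 in \<open>pos\<close>.\<close>
  define c where "c = (t + 1) / (t - 1)"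
  have c: "c \<ge> 2" "t * (c - 1) = c + 1"
    using False t by (auto simp: c_def field_simps)
  then have cc: "c * c - 2 > 0"
    using mult_mono[of 2 c 2 c] by simp
  have "(c * c - 2) *\<^sub>R (1 + inverse (c * c - 2) *\<^sub>R (2 *\<^sub>R 1 - w * w)) \<in> units"
    using pos cc units_scaleR_iff by (simp add: positive_def)
  also have "(c * c - 2) *\<^sub>R (1 + inverse (c * c - 2) *\<^sub>R (2 *\<^sub>R 1 - w * w)) = (c * c) *\<^sub>R 1 - w * w"
    using right_inverse[of "c * c - 2"] cc
    by (simp only: scaleR_right_distrib scaleR_scaleR) (simp add: scaleR_left_diff_distrib)
  finally have cw: "(c * c) *\<^sub>R 1 - w * w \<in> units" .
  have "(c *\<^sub>R 1 - w) * (c *\<^sub>R 1 + w) = (c * c) *\<^sub>R 1 - w * w"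
    "(c *\<^sub>R 1 + w) * (c *\<^sub>R 1 - w) = (c * c) *\<^sub>R 1 - w * w"
    by (simp_all add: algebra_simps)
  with cw have "c *\<^sub>R 1 - w \<in> units"
    by (metis units_of_both_products)
  then have "(c *\<^sub>R 1 - w) * (1 + h) \<in> units"
    using u by (rule units_mult(1))
  also have "(c *\<^sub>R 1 - w) * (1 + h) = (c + 1) *\<^sub>R (1 + h) - v * (1 + h)"
    by (simp add: w_def algebra_simps)
  also have "\<dots> = (c - 1) *\<^sub>R (1 + t *\<^sub>R h)"
  proof -
    have "(c - 1) *\<^sub>R (1 + t *\<^sub>R h) = (c - 1) *\<^sub>R 1 + (t * (c - 1)) *\<^sub>R h"
      by (simp add: scaleR_right_distrib mult.commute)
    then show ?thesis
      unfolding v(2) c(2) by (simp add: scaleR_left_distrib scaleR_left_diff_distrib scaleR_right_distrib scaleR_2)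
  qed
  finally show ?thesis
    using c units_scaleR_iff by (simp add: h_def)
qed (use seg t in auto)

text \<open>The Shirali-Ford theorem. Openness of the units gives an initial interval for t, and the
  extension step for \<open>sqrt r *\<^sub>R a\<close> stretches [0, r] to [0, 3 r].\<close>

theorem positive_star_mult: "positive (star a * a)"
proof -
  have "continuous_on UNIV (\<lambda>t::real. 1 + t *\<^sub>R (star a * a))"
    by (intro continuous_intros)
  then have "open ((\<lambda>t::real. 1 + t *\<^sub>R (star a * a)) -` units)"
    using open_units by (intro open_vimage)
  moreover have "0 \<in> (\<lambda>t::real. 1 + t *\<^sub>R (star a * a)) -` units"
    using one_in_units by simp
  ultimately obtain e where e: "e > 0" "ball 0 e \<subseteq> (\<lambda>t::real. 1 + t *\<^sub>R (star a * a)) -` units"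
    using open_contains_ball by blast
  define d where "d = e / 2"
  have d: "d > 0"
    using e by (simp add: d_def)
  have "1 + t *\<^sub>R (star a * a) \<in> units" if "0 \<le> t" "t \<le> d * 3 ^ n" for t n
    using that
  proof (induction n arbitrary: t)
    case 0
    then have "t \<in> ball 0 e"
      using e by (auto simp: d_def)
    then show ?case
      using e by auto
  next
    case (Suc n)
    define r where "r = d * 3 ^ n"
    have r: "r > 0" "sqrt r * sqrt r = r"
      using d by (simp_all add: r_def)
    have scale: "star (sqrt r *\<^sub>R a) * (sqrt r *\<^sub>R a) = r *\<^sub>R (star a * a)"
      using r by (simp add: star_simps)
    have "1 + (t / r) *\<^sub>R (star (sqrt r *\<^sub>R a) * (sqrt r *\<^sub>R a)) \<in> units"
    proof (rule one_plus_star_mult_extend)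
      fix s :: real assume "s \<in> {0..1}"
      then have "0 \<le> s * r" "s * r \<le> r"
        using r by (auto intro: mult_left_le_one_le)
      then show "1 + s *\<^sub>R (star (sqrt r *\<^sub>R a) * (sqrt r *\<^sub>R a)) \<in> units"
        using Suc.IH[of "s * r"] by (simp only: scale scaleR_scaleR r_def[symmetric])
    qed (use Suc.prems r in \<open>auto simp: r_def field_simps\<close>)
    then show ?case
      using r(1) unfolding scale by simp
  qed
  moreover have "\<exists>n. t \<le> d * 3 ^ n" for t
    using real_arch_pow[of 3 "t / d"] d by (auto simp: field_simps intro: less_imp_le)
  ultimately have "1 + t *\<^sub>R (star a * a) \<in> units" if "t \<ge> 0" for t
    using that by blast
  then show ?thesis
    by (simp add: positive_def star_simps)
qed

lemma unit_segment_star_mult: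
  assumes "w \<in> units"
  shows "unit_segment 1 (star w * w)"
  unfolding unit_segment_def
proof
  fix t :: real assume t: "t \<in> {0..1}"
  show "(1 - t) *\<^sub>R 1 + t *\<^sub>R (star w * w) \<in> units"
  proof (cases "t = 1")
    case True
    then show ?thesis
      using assms star_unit_inv(1) units_mult(1) by auto
  next
    case False
    have "(1 - t) *\<^sub>R (1 + (t / (1 - t)) *\<^sub>R (star w * w)) \<in> units"
      using positive_star_mult[of w] t False units_scaleR_iff by (simp add: positive_def)
    then show ?thesis
      using False by (simp add: scaleR_right_distrib)
  qed
qed

end

section \<open>The matrix algebra as a hermitian continuous inverse algebra\<close>

lemmas mat2_defs = zero_mat2_def one_mat2_def plus_mat2_def minus_mat2_def uminus_mat2_def times_mat2_def

instantiation mat2 :: (real_algebra) real_algebra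
begin

definition "r *\<^sub>R A = Mat2 (r *\<^sub>R ent11 A) (r *\<^sub>R ent12 A) (r *\<^sub>R ent21 A) (r *\<^sub>R ent22 A)"

instance
  by standard (simp_all add: scaleR_mat2_def mat2_defs algebra_simps)

end

definition mat2_of_tuple :: "'a \<times> 'a \<times> 'a \<times> 'a \<Rightarrow> 'a mat2" where
  "mat2_of_tuple = (\<lambda>(a, b, c, d). Mat2 a b c d)"

instantiation mat2 :: (topological_space) topological_space
begin

text \<open>The topology making \<open>mat2_of_tuple\<close> a homeomorphism, that is, the product
  topology.\<close>

definition open_mat2 :: "'a mat2 set \<Rightarrow> bool" where
  "open_mat2 U \<longleftrightarrow> open (mat2_of_tuple -` U)"

instance
  by standard (auto simp: open_mat2_def vimage_Union)

end

lemma continuous_on_mat2_of_tuple: "continuous_on UNIV mat2_of_tuple"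
  by (simp add: continuous_on_open_vimage open_mat2_def)

lemma continuous_on_Mat2 [continuous_intros]:
  assumes "continuous_on S f" "continuous_on S g" "continuous_on S h" "continuous_on S k"
  shows "continuous_on S (\<lambda>x. Mat2 (f x) (g x) (h x) (k x))"
proof -
  have "continuous_on S (\<lambda>x. mat2_of_tuple (f x, g x, h x, k x))"
    by (rule continuous_on_compose2[OF continuous_on_mat2_of_tuple])
      (auto intro!: continuous_intros assms)
  then show ?thesis
    by (simp add: mat2_of_tuple_def)
qed

lemma continuous_on_entries:
  shows "continuous_on UNIV (ent11 :: 'a::topological_space mat2 \<Rightarrow> 'a)" "continuous_on UNIV (ent12 :: 'a mat2 \<Rightarrow> 'a)"
    "continuous_on UNIV (ent21 :: 'a mat2 \<Rightarrow> 'a)" "continuous_on UNIV (ent22 :: 'a mat2 \<Rightarrow> 'a)"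
proof -
  have *: "continuous_on UNIV f" if "continuous_on UNIV (\<lambda>p. f (mat2_of_tuple p))"
    for f :: "'a mat2 \<Rightarrow> 'a"
    unfolding continuous_on_open_vimage[OF open_UNIV]
    using open_vimage[OF _ that] by (simp add: open_mat2_def vimage_def)
  show "continuous_on UNIV (ent11 :: 'a mat2 \<Rightarrow> 'a)" "continuous_on UNIV (ent12 :: 'a mat2 \<Rightarrow> 'a)"
    "continuous_on UNIV (ent21 :: 'a mat2 \<Rightarrow> 'a)" "continuous_on UNIV (ent22 :: 'a mat2 \<Rightarrow> 'a)"
    by (rule *, simp add: mat2_of_tuple_def case_prod_unfold, intro continuous_intros)+
qed

lemmas continuous_on_entries_compose [continuous_intros] =
  continuous_on_entries[THEN continuous_on_compose2, OF _ subset_UNIV]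

instance mat2 :: (t2_space) t2_space
proof
  fix A B :: "'a mat2" assume "A \<noteq> B"
  then have "ent11 A \<noteq> ent11 B \<or> ent12 A \<noteq> ent12 B \<or> ent21 A \<noteq> ent21 B \<or> ent22 A \<noteq> ent22 B"
    using mat2.expand[of A B] by blast
  then obtain f :: "'a mat2 \<Rightarrow> 'a" where f: "continuous_on UNIV f" "f A \<noteq> f B"
    using continuous_on_entries by metis
  from hausdorff[OF f(2)] obtain U V where UV: "open U" "open V" "f A \<in> U" "f B \<in> V" "U \<inter> V = {}"
    by blast
  then show "\<exists>U V. open U \<and> open V \<and> A \<in> U \<and> B \<in> V \<and> U \<inter> V = {}"
    using f(1) by (intro exI[of _ "f -` U"] exI[of _ "f -` V"]) (auto intro: open_vimage)
qed

text \<open>The topological class axioms speak of products of neighbourhood filters; this derives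
  them from continuity on the product space.\<close>

lemma filterlim_pair_nhds:
  assumes "continuous_on UNIV (\<lambda>p. f (fst p) (snd p))"
  shows "((\<lambda>p. f (fst p) (snd p)) \<longlongrightarrow> f a b) (nhds a \<times>\<^sub>F nhds b)"
proof -
  have "((\<lambda>p. f (fst p) (snd p)) \<longlongrightarrow> f (fst (a, b)) (snd (a, b))) (at (a, b))"
    using assms unfolding continuous_on_def by blast
  then have "((\<lambda>p. f (fst p) (snd p)) \<longlongrightarrow> f (fst (a, b)) (snd (a, b))) (nhds (a, b))"
    by (rule tendsto_at_iff_tendsto_nhds[THEN iffD1])
  then show ?thesis
    by (simp only: nhds_prod fst_conv snd_conv)
qed

instance mat2 :: ("{ring, topological_ab_group_add}") topological_ab_group_add
proof
  fix A B :: "'a mat2"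
  show "((\<lambda>p. fst p + snd p) \<longlongrightarrow> A + B) (nhds A \<times>\<^sub>F nhds B)"
    by (intro filterlim_pair_nhds, unfold plus_mat2_def) (intro continuous_intros)
  have "continuous_on UNIV (uminus :: 'a mat2 \<Rightarrow> _)"
    unfolding uminus_mat2_def by (intro continuous_intros)
  then show "(uminus \<longlongrightarrow> - A) (nhds A)"
    unfolding continuous_on_def by (auto simp flip: tendsto_at_iff_tendsto_nhds)
qed

instance mat2 :: ("{ring, topological_monoid_add, topological_semigroup_mult}") topological_semigroup_mult
proof
  fix A B :: "'a mat2"
  show "((\<lambda>p. fst p * snd p) \<longlongrightarrow> A * B) (nhds A \<times>\<^sub>F nhds B)"
    by (intro filterlim_pair_nhds, unfold times_mat2_def) (intro continuous_intros)
qed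

section \<open>The matrices as a continuous inverse algebra\<close>

definition mat2_scaleC :: "(complex \<Rightarrow> 'a \<Rightarrow> 'a) \<Rightarrow> complex \<Rightarrow> 'a mat2 \<Rightarrow> 'a mat2" where
  "mat2_scaleC scaleC c A =
    Mat2 (scaleC c (ent11 A)) (scaleC c (ent12 A)) (scaleC c (ent21 A)) (scaleC c (ent22 A))"

text \<open>Left translation by a unit carries a neighbourhood of 1 to one of that unit, so both
  properties need checking only near 1.\<close>

lemma open_units_continuous_unit_invI:
  fixes W :: "'c::{monoid_mult, topological_semigroup_mult, t2_space} set"
  assumes W: "open W" "1 \<in> W" "W \<subseteq> units" "continuous_on W unit_inv"
  shows "open (units :: 'c set)" "continuous_on (units :: 'c set) unit_inv"
proof -
  define N where "N a = (\<lambda>x. unit_inv a * x) -` W" for a :: 'c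
  have cont: "continuous_on UNIV (\<lambda>x. unit_inv a * x)" for a :: 'c
    by (intro continuous_intros)
  have N: "open (N a)" "a \<in> N a" "N a \<subseteq> units" if "a \<in> units" for a
  proof -
    show "open (N a)"
      unfolding N_def using W(1) cont by (rule open_vimage)
    show "a \<in> N a"
      using that W(2) by (simp add: N_def units_inv)
    show "N a \<subseteq> units"
      using W(3) units_cancel_left unit_inv_in_units[OF that] by (auto simp: N_def)
  qed
  show "open (units :: 'c set)"
    unfolding open_subopen[of units] using N by blast
  have cont_N: "continuous_on (N a) unit_inv" if a: "a \<in> units" for a
  proof -
    have eq: "unit_inv x = unit_inv (unit_inv a * x) * unit_inv a" if "x \<in> N a" for x
    proof -
      have "x = a * (unit_inv a * x)"
        using units_inv(1)[OF a] by (metis mult.assoc mult_1_left)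
      then show ?thesis
        using units_mult(2)[OF a, of "unit_inv a * x"] that W(3) by (auto simp: N_def)
    qed
    have "continuous_on (N a) (\<lambda>x. unit_inv (unit_inv a * x) * unit_inv a)"
      by (intro continuous_intros continuous_on_compose2[OF W(4)] continuous_on_subset[OF cont])
        (auto simp: N_def)
    then show ?thesis
      by (rule continuous_on_eq) (rule eq[symmetric])
  qed
  show "continuous_on (units :: 'c set) unit_inv"
  proof (rule continuous_at_imp_continuous_on, rule ballI)
    fix a :: 'c assume "a \<in> units"
    then show "isCont unit_inv a"
      using N cont_N continuous_on_eq_continuous_at by blast
  qed
qed

text \<open>Block Gaussian elimination with pivot \<open>a\<close>; \<open>s\<close> inverts the
  Schur complement.\<close>

lemma mat2_schur:
  fixes a b c d :: "'a::{ring, monoid_mult}"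
  assumes "a \<in> units" "d - c * unit_inv a * b \<in> units"
  defines "i \<equiv> unit_inv a" and "s \<equiv> unit_inv (d - c * unit_inv a * b)"
  shows "Mat2 a b c d \<in> units"
    "unit_inv (Mat2 a b c d) = Mat2 (i + i * b * s * c * i) (- (i * b * s)) (- (s * c * i)) s"
proof -
  let ?N = "Mat2 (i + i * b * s * c * i) (- (i * b * s)) (- (s * c * i)) s"
  have i: "a * i = 1" "i * a = 1" "\<And>x. a * (i * x) = x" "\<And>x. i * (a * x) = x"
    using units_inv[OF assms(1)] by (simp_all add: i_def flip: mult.assoc)
  have s: "(d - c * i * b) * s = 1" "s * (d - c * i * b) = 1"
    using units_inv[OF assms(2)] by (simp_all add: i_def s_def)
  then have ds: "d * s = 1 + c * (i * (b * s))" "s * d = 1 + s * (c * (i * b))"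
    by (simp_all add: algebra_simps)
  have ds': "d * (s * x) = x + c * (i * (b * (s * x)))" "s * (d * x) = x + s * (c * (i * (b * x)))" for x
    using arg_cong[OF ds(1), of "\<lambda>y. y * x"] arg_cong[OF ds(2), of "\<lambda>y. y * x"]
    by (simp_all add: distrib_right mult.assoc)
  have 1: "Mat2 a b c d * ?N = 1"
    by (simp add: mat2_defs distrib_left distrib_right mult.assoc i ds ds')
  have 2: "?N * Mat2 a b c d = 1"
    by (simp add: mat2_defs distrib_left distrib_right mult.assoc i ds ds')
  show "Mat2 a b c d \<in> units" "unit_inv (Mat2 a b c d) = ?N"
    using unitsI[OF 1 2] unit_inv_eqI[OF 1 2] .
qed

context continuous_inverse_algebra
begin

lemma mat2_open_units_continuous_unit_inv:
  "open (units :: 'a mat2 set)" "continuous_on (units :: 'a mat2 set) unit_inv"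
proof -
  define schur where "schur M = ent22 M - ent21 M * unit_inv (ent11 M) * ent12 M" for M :: "'a mat2"
  define W0 where "W0 = ent11 -` (units :: 'a set)"
  \<comment> \<open>Near 1 the pivot and the Schur complement are units; units with a singular pivot
    are reached by translation.\<close>
  define W where "W = W0 \<inter> schur -` units"
  have W0: "open W0"
    unfolding W0_def using open_units by (intro open_vimage continuous_on_entries)
  have schur: "continuous_on W0 schur"
    unfolding schur_def by (intro continuous_intros) (simp_all add: W0_def)
  then have "open W"
    unfolding W_def using W0 open_units continuous_on_open_vimage[OF W0] by (metis inf_commute)
  moreover have "1 \<in> W"
    by (simp add: W_def W0_def schur_def one_mat2_def one_in_units)
  moreover have "W \<subseteq> units"
  proof
    fix M assume "M \<in> W"
    then show "M \<in> units"
      using mat2_schur(1)[of "ent11 M" "ent22 M" "ent21 M" "ent12 M"] by (simp add: W_def W0_def schur_def)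
  qed
  moreover have "continuous_on W unit_inv"
  proof -
    let ?i = "\<lambda>M :: 'a mat2. unit_inv (ent11 M)" and ?s = "\<lambda>M. unit_inv (schur M)"
    have eq: "Mat2 (?i M + ?i M * ent12 M * ?s M * ent21 M * ?i M) (- (?i M * ent12 M * ?s M))
        (- (?s M * ent21 M * ?i M)) (?s M) = unit_inv M" if "M \<in> W" for M
      using mat2_schur(2)[of "ent11 M" "ent22 M" "ent21 M" "ent12 M"] that
      by (simp add: W_def W0_def schur_def)
    have "continuous_on W schur"
      using schur by (rule continuous_on_subset) (simp add: W_def)
    then have "continuous_on W (\<lambda>M. Mat2 (?i M + ?i M * ent12 M * ?s M * ent21 M * ?i M)
        (- (?i M * ent12 M * ?s M)) (- (?s M * ent21 M * ?i M)) (?s M))"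
      by (intro continuous_intros) (simp_all add: W_def W0_def)
    then show ?thesis
      by (rule continuous_on_eq) (rule eq)
  qed
  ultimately show "open (units :: 'a mat2 set)" "continuous_on (units :: 'a mat2 set) unit_inv"
    using open_units_continuous_unit_invI by blast+
qed

lemma mat2_locally_convex:
  assumes "open (U :: 'a mat2 set)" "0 \<in> U"
  shows "\<exists>V. open V \<and> convex V \<and> 0 \<in> V \<and> V \<subseteq> U"
proof -
  have "open (mat2_of_tuple -` U)" "(0, 0, 0, 0) \<in> mat2_of_tuple -` U"
    using assms by (simp_all add: open_mat2_def mat2_of_tuple_def zero_mat2_def)
  then obtain A R where A: "open A" "open R" "(0, 0, 0, 0) \<in> A \<times> R" "A \<times> R \<subseteq> mat2_of_tuple -` U"
    by (rule open_prod_elim)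
  then have "(0, 0, 0) \<in> R"
    by blast
  with A(2) obtain B S where B: "open B" "open S" "(0, 0, 0) \<in> B \<times> S" "B \<times> S \<subseteq> R"
    by (rule open_prod_elim)
  then have "(0, 0) \<in> S"
    by blast
  with B(2) obtain C D where C: "open C" "open D" "(0, 0) \<in> C \<times> D" "C \<times> D \<subseteq> S"
    by (rule open_prod_elim)
  have zero: "0 \<in> A" "0 \<in> B" "0 \<in> C" "0 \<in> D"
    using A(3) B(3) C(3) by blast+
  have ABCD: "A \<times> B \<times> C \<times> D \<subseteq> mat2_of_tuple -` U"
    using A(4) B(4) C(4) by blast
  obtain A' B' C' D' where
    A': "open A'" "convex A'" "0 \<in> A'" "A' \<subseteq> A" and B': "open B'" "convex B'" "0 \<in> B'" "B' \<subseteq> B" and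
    C': "open C'" "convex C'" "0 \<in> C'" "C' \<subseteq> C" and D': "open D'" "convex D'" "0 \<in> D'" "D' \<subseteq> D"
    using locally_convex A(1) B(1) C(1,2) zero by meson
  define V where "V = ent11 -` A' \<inter> ent12 -` B' \<inter> ent21 -` C' \<inter> ent22 -` D'"
  have "open V"
    unfolding V_def using A' B' C' D' by (intro open_Int open_vimage continuous_on_entries)
  moreover have "convex V"
    unfolding V_def using A' B' C' D'
    by (auto simp: convex_def scaleR_mat2_def plus_mat2_def)
  moreover have "0 \<in> V"
    using A' B' C' D' by (simp add: V_def zero_mat2_def)
  moreover have "V \<subseteq> U"
  proof
    fix M assume "M \<in> V"
    then have "(ent11 M, ent12 M, ent21 M, ent22 M) \<in> A \<times> B \<times> C \<times> D"
      using A' B' C' D' by (auto simp: V_def)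
    then have "(ent11 M, ent12 M, ent21 M, ent22 M) \<in> mat2_of_tuple -` U"
      using ABCD by blast
    then show "M \<in> U"
      by (simp add: mat2_of_tuple_def)
  qed
  ultimately show ?thesis
    by blast
qed

lemma mat2_continuous_inverse_algebra: "continuous_inverse_algebra (mat2_scaleC scaleC)"
proof
  show "continuous_on UNIV (\<lambda>(c, x). mat2_scaleC scaleC c x)"
    unfolding mat2_scaleC_def case_prod_unfold by (intro continuous_intros)
  show "\<exists>V. open V \<and> convex V \<and> 0 \<in> V \<and> V \<subseteq> U" if "open U" "0 \<in> U" for U :: "'a mat2 set"
    using that by (rule mat2_locally_convex)
  show "open (units :: 'a mat2 set)" "continuous_on (units :: 'a mat2 set) unit_inv"
    by (rule mat2_open_units_continuous_unit_inv)+
qed (simp_all add: mat2_scaleC_def scaleR_mat2_def mat2_defs scaleC_of_real mult_scaleC_left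
    mult_scaleC_right scaleC.scale_right_distrib scaleC.scale_left_distrib)

end

section \<open>Mackey completeness, entry by entry\<close>

lemma tvs_bounded_linear_image:
  fixes f :: "'a::{real_vector, topological_space} \<Rightarrow> 'b::{real_vector, topological_space}"
  assumes "linear f" "continuous_on UNIV f" "tvs_bounded B"
  shows "tvs_bounded (f ` B)"
  unfolding tvs_bounded_def
proof (intro allI impI)
  fix U :: "'b set" assume U: "open U" "0 \<in> U"
  then have "open (f -` U)" "0 \<in> f -` U"
    using assms(1,2) by (auto intro: open_vimage simp: linear_0)
  then obtain t where "t > 0" "B \<subseteq> (*\<^sub>R) t ` (f -` U)"
    using assms(3) by (auto simp: tvs_bounded_def)
  then show "\<exists>t>0. f ` B \<subseteq> (*\<^sub>R) t ` U"
    by (intro exI[of _ t]) (auto simp: linear_scale[OF assms(1)])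
qed

lemma mackey_Cauchy_linear_image:
  fixes f :: "'a::{real_vector, topological_space} \<Rightarrow> 'b::{real_vector, topological_space}"
  assumes f: "linear f" "continuous_on UNIV f" and x: "mackey_Cauchy x"
  shows "mackey_Cauchy (\<lambda>n. f (x n))"
proof -
  obtain B \<mu> where B: "tvs_bounded B" "(\<mu> \<longlongrightarrow> (0::real)) (sequentially \<times>\<^sub>F sequentially)"
    "\<And>m n. x m - x n \<in> (*\<^sub>R) (\<mu> (m, n)) ` B"
    using x by (auto simp: mackey_Cauchy_def)
  have "f (x m) - f (x n) \<in> (*\<^sub>R) (\<mu> (m, n)) ` f ` B" for m n
  proof -
    obtain b where "b \<in> B" "x m - x n = \<mu> (m, n) *\<^sub>R b"
      using B(3) by blast
    then have "f (x m) - f (x n) = \<mu> (m, n) *\<^sub>R f b"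
      by (metis f(1) linear_diff linear_scale)
    then show ?thesis
      using \<open>b \<in> B\<close> by blast
  qed
  then show ?thesis
    unfolding mackey_Cauchy_def using tvs_bounded_linear_image[OF f B(1)] B(2) by blast
qed

lemma linear_entries:
  "linear ent11" "linear ent12" "linear ent21" "linear (ent22 :: 'a::real_algebra mat2 \<Rightarrow> 'a)"
  by (auto intro!: linearI simp: plus_mat2_def scaleR_mat2_def)

lemma mat2_mackey_complete:
  assumes "mackey_complete TYPE('a::{real_algebra, t2_space})"
  shows "mackey_complete TYPE('a mat2)"
  unfolding mackey_complete_def
proof (intro allI impI)
  fix X :: "nat \<Rightarrow> 'a mat2" assume X: "mackey_Cauchy X"
  have conv: "\<exists>l. (\<lambda>n. f (X n)) \<longlonglongrightarrow> l" if "linear f" "continuous_on UNIV f" for f :: "'a mat2 \<Rightarrow> 'a"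
    using mackey_Cauchy_linear_image[OF that X] assms by (auto simp: mackey_complete_def convergent_def)
  obtain a b c d where lim: "(\<lambda>n. ent11 (X n)) \<longlonglongrightarrow> a" "(\<lambda>n. ent12 (X n)) \<longlonglongrightarrow> b"
    "(\<lambda>n. ent21 (X n)) \<longlonglongrightarrow> c" "(\<lambda>n. ent22 (X n)) \<longlonglongrightarrow> d"
    using conv linear_entries continuous_on_entries by metis
  have "(\<lambda>n. (ent11 (X n), ent12 (X n), ent21 (X n), ent22 (X n))) \<longlonglongrightarrow> (a, b, c, d)"
    by (intro tendsto_Pair lim)
  then have "(\<lambda>n. mat2_of_tuple (ent11 (X n), ent12 (X n), ent21 (X n), ent22 (X n)))
      \<longlonglongrightarrow> mat2_of_tuple (a, b, c, d)"
    by (rule continuous_on_tendsto_compose[OF continuous_on_mat2_of_tuple]) auto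
  then show "convergent X"
    by (auto simp: mat2_of_tuple_def convergent_def)
qed

lemma mat2_algebra_involution:
  assumes "algebra_involution scaleC star"
  shows "algebra_involution (mat2_scaleC scaleC) (mat2_star star)"
  using assms by (simp add: algebra_involution_def mat2_star_def mat2_scaleC_def mat2_defs add.commute)

section \<open>Hermiticity of the matrix algebra\<close>

context hermitian_cia
begin

lemma i_plus_in_units:
  assumes "star x = x"
  shows "scaleC \<i> 1 + x \<in> units"
proof -
  have "scaleC \<i> (1 + scaleC (- \<i>) x) \<in> units"
    using one_plus_nonreal_in_units[OF assms, of "- \<i>"] units_scaleC_iff by simp
  moreover have "scaleC \<i> (1 + scaleC (- \<i>) x) = scaleC \<i> 1 + x"
    by (simp add: scaleC.scale_right_diff_distrib)
  ultimately show ?thesis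
    by (simp only:)
qed

text \<open>The Schur complement of \<open>i + a\<close> in \<open>i + H\<close> is \<open>h + i k\<close> with \<open>h\<close> hermitian and
  \<open>k = 1 + b\<^sup>* (1 + a\<^sup>2)\<^sup>-\<^sup>1 b\<close>; it is congruent to \<open>k\<^bsup>-1/2\<^esup> h k\<^bsup>-1/2\<^esup> + i\<close>.\<close>

lemma mat2_i_plus_in_units:
  assumes "mat2_star star H = H"
  shows "mat2_scaleC scaleC \<i> 1 + H \<in> units"
proof -
  obtain a b c d where H: "H = Mat2 a b c d"
    by (cases H)
  have sH: "star a = a" "star b = c" "star c = b" "star d = d"
    using assms by (simp_all add: H mat2_star_def)
  have "star (1 + a * a) = 1 + a * a"
    by (simp add: star_simps sH)
  moreover have "unit_segment 1 (1 + a * a)"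
    using positive_square[OF sH(1)] by (auto simp: unit_segment_def positive_def algebra_simps)
  ultimately obtain r where r: "star r = r" "r * r * (1 + a * a) = 1" "\<And>x. (1 + a * a) * x = x * (1 + a * a) \<Longrightarrow> r * x = x * r"
    using hermitian_inverse_square_root by metis
  have ra: "r * a = a * r"
    by (rule r(3)) (simp add: algebra_simps)
  define A where "A = scaleC \<i> 1 + a"
  \<comment> \<open>This is (a - i) (1 + a^2)^(-1), the inverse of A = i + a.\<close>
  define A' where "A' = (a - scaleC \<i> 1) * (r * r)"
  have A: "A \<in> units"
    unfolding A_def using i_plus_in_units sH(1) by blast
  have comm: "A * (r * r) = (r * r) * A"
    using ra by (simp add: A_def distrib_left distrib_right mult_scaleC_left mult_scaleC_right) (metis mult.assoc)
  have "(a - scaleC \<i> 1) * A = 1 + a * a"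
    by (simp add: A_def distrib_left left_diff_distrib mult_scaleC_left mult_scaleC_right
        scaleC.scale_right_diff_distrib)
  then have "(a - scaleC \<i> 1) * A * (r * r) = 1"
    using r(2) ra by (simp add: distrib_left distrib_right) (metis mult.assoc)
  then have "A' * A = 1"
    by (simp add: A'_def comm mult.assoc)
  then have A': "unit_inv A = A'"
    using A by (metis mult.assoc mult_1_left mult_1_right units_inv(1))
  \<comment> \<open>Splitting the inverse of i + a into a (1 + a^2)^(-1) and -i (1 + a^2)^(-1)
    separates the Schur complement into \<open>h\<close> and i times \<open>k\<close>.\<close>
  define h where "h = d - c * (a * r * r) * b"
  define k where "k = 1 + star (r * b) * (r * b)"
  have "star (a * r * r) = a * r * r"
    using ra by (simp add: star_simps sH r(1)) (metis mult.assoc)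
  then have h: "star h = h"
    by (simp add: h_def star_simps sH mult.assoc)
  have "star k = k" "unit_segment 1 k"
    using positive_star_mult[of "r * b"]
    by (auto simp: k_def star_simps unit_segment_def positive_def algebra_simps)
  then obtain S where S: "star S = S" "S \<in> units" "S * k * S = 1"
    using hermitian_inverse_square_root by metis
  have schur: "(scaleC \<i> 1 + d) - c * unit_inv A * b = h + scaleC \<i> k"
    by (simp add: A' A'_def h_def k_def star_simps r(1) sH algebra_simps mult_scaleC_left
        mult_scaleC_right scaleC.scale_right_distrib)
  have "S * ((h + scaleC \<i> k) * S) = scaleC \<i> (S * k * S) + S * h * S"
    by (simp add: algebra_simps mult_scaleC_left mult_scaleC_right)
  moreover have "star (S * h * S) = S * h * S"
    by (simp add: star_simps S h mult.assoc)
  ultimately have "S * ((h + scaleC \<i> k) * S) \<in> units"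
    using i_plus_in_units S(3) by metis
  then have "h + scaleC \<i> k \<in> units"
    using S(2) units_cancel_left units_cancel_right by blast
  then have "Mat2 A b c (scaleC \<i> 1 + d) \<in> units"
    using A by (intro mat2_schur(1)) (simp_all add: schur)
  then show ?thesis
    by (simp add: H A_def mat2_scaleC_def mat2_defs)
qed

theorem mat2_hermitian_cia: "hermitian_cia (mat2_scaleC scaleC) (mat2_star star)"
proof -
  interpret M: continuous_inverse_algebra "mat2_scaleC scaleC"
    by (rule mat2_continuous_inverse_algebra)
  have inv: "algebra_involution (mat2_scaleC scaleC) (mat2_star star)"
    using involution by (rule mat2_algebra_involution)
  show ?thesis
  proof
    show "mackey_complete TYPE('a mat2)"
      using mackey_complete by (rule mat2_mackey_complete)
    have star: "continuous_on UNIV (\<lambda>A. star (f A))" if "continuous_on UNIV f" for f :: "'a mat2 \<Rightarrow> 'a"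
      using continuous_on_compose2[OF continuous_star that] by simp
    show "continuous_on UNIV (mat2_star star)"
      unfolding mat2_star_def by (intro continuous_on_Mat2 star continuous_on_entries)
    show "hermitian (mat2_scaleC scaleC) (mat2_star star)"
      unfolding hermitian_def
    proof (intro allI impI subsetI)
      fix H z assume H: "H = mat2_star star H" and z: "z \<in> spectrum (mat2_scaleC scaleC) H"
      show "z \<in> \<real>"
      proof (rule ccontr)
        assume "z \<notin> \<real>"
        then have y: "Im z \<noteq> 0"
          using complex_is_Real_iff by blast
        \<comment> \<open>Since z - H = Im z (i + G), a nonreal z is reduced to i.\<close>
        define G where "G = inverse (Im z) *\<^sub>R (Re z *\<^sub>R 1 - H)"
        have "mat2_star star G = G"
          using H by (simp add: G_def scaleR_mat2_def mat2_defs mat2_star_def star_simps mat2.expand) (metis mat2.sel)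
        then have "Im z *\<^sub>R (mat2_scaleC scaleC \<i> 1 + G) \<in> units"
          using mat2_i_plus_in_units M.units_scaleR_iff y by blast
        also have "Im z *\<^sub>R (mat2_scaleC scaleC \<i> 1 + G) = mat2_scaleC scaleC (of_real (Im z) * \<i>) 1 + (Re z *\<^sub>R 1 - H)"
        proof -
          have "Im z *\<^sub>R mat2_scaleC scaleC \<i> 1 = mat2_scaleC scaleC (of_real (Im z) * \<i>) 1"
            by (simp only: M.scaleC_of_real[symmetric] M.scaleC.scale_scale)
          then show ?thesis
            using y by (simp add: G_def scaleR_right_distrib)
        qed
        also have "\<dots> = mat2_scaleC scaleC (of_real (Im z) * \<i> + of_real (Re z)) 1 - H"
          by (simp add: M.scaleC.scale_left_distrib M.scaleC_of_real)
        also have "of_real (Im z) * \<i> + of_real (Re z) = z"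
          by (simp add: complex_eq_iff)
        finally show False
          using z by (simp add: spectrum_def)
      qed
    qed
  qed (rule inv)
qed

end

section \<open>Unitary transitivity on flag manifolds\<close>

lemma flagsE:
  assumes "X \<in> flags n"
  obtains ps where "ps \<in> idem_chains n" "X = flag_rel n `` {ps}"
  using assms by (auto simp: flags_def quotient_def)

lemma flag_class_eqI:
  assumes "(ps, qs) \<in> flag_rel n"
  shows "flag_rel n `` {ps} = flag_rel n `` {qs}"
  using equiv_flag_rel assms by (rule equiv_class_eq)

lemma conj_mult_conj:
  fixes g :: "'c::monoid_mult"
  assumes "g \<in> units"
  shows "(g * p * unit_inv g) * (g * q * unit_inv g) = g * (p * q) * unit_inv g"
  by (metis assms mult.assoc mult_1_left units_inv(2))

lemma idem_chain_idempotent: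
  fixes ps :: "'c::monoid_mult list"
  assumes "ps \<in> idem_chains n" "i < n"
  shows "ps ! i * ps ! i = ps ! i"
proof -
  have "set ps \<subseteq> idempotents" "length ps = n"
    using assms(1) by (auto simp: idem_chains_def)
  then have "ps ! i \<in> idempotents"
    using nth_mem assms(2) by blast
  then show ?thesis
    by (simp add: idempotents_def)
qed

lemma idem_chain_nth_le:
  fixes ps :: "'c::monoid_mult list"
  assumes "ps \<in> idem_chains n" "i \<le> j" "j < n"
  shows "ps ! j * ps ! i = ps ! i"
  using assms(2,3)
proof (induction j)
  case 0
  then show ?case
    using idem_chain_idempotent[OF assms(1), of 0] by simp
next
  case (Suc j)
  show ?case
  proof (cases "i = Suc j")
    case True
    then show ?thesis
      using idem_chain_idempotent[OF assms(1), of "Suc j"] Suc.prems by simp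
  next
    case False
    then have "ps ! j * ps ! i = ps ! i"
      using Suc by simp
    moreover have "ps ! Suc j * ps ! j = ps ! j"
      using assms(1) Suc.prems by (auto simp: idem_chains_def successively_conv_nth idem_le_def)
    ultimately show ?thesis
      by (metis mult.assoc)
  qed
qed

text \<open>The block diagonal part of \<open>w\<close> with respect to \<open>q\<close> and \<open>q'\<close>; it preserves
  all the compatibility relations and hence can be taken for one projection after the other.\<close>

lemma block_diagonal:
  fixes w v q q' :: "'c::{ring, monoid_mult}"
  assumes inv: "w * v = 1" and q: "q * q = q" "q' * q' = q'"
    and compat: "q' * w * q = w * q" "q * v * q' = v * q'"
  defines "w1 \<equiv> q' * w * q + (1 - q') * w * (1 - q)" and "v1 \<equiv> q * v * q' + (1 - q) * v * (1 - q')"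
  shows "w1 * v1 = 1" "w1 * q = q' * w1"
proof -
  have qq: "q * (q * x) = q * x" "q' * (q' * x) = q' * x" for x
    using q by (metis mult.assoc)+
  have wv: "w * (v * x) = x" for x
    using inv by (metis mult.assoc mult_1_left)
  have wq: "q' * (w * q) = w * q" "q' * (w * (q * x)) = w * (q * x)"
    "q * (v * q') = v * q'" "q * (v * (q' * x)) = v * (q' * x)" for x
    using compat by (metis mult.assoc)+
  show "w1 * q = q' * w1"
    by (simp add: w1_def algebra_simps q qq wq)
  show "w1 * v1 = 1"
    by (simp add: w1_def v1_def algebra_simps q qq wq wv inv)
qed

text \<open>The disjunction says that q, r are nested and q', r' are nested in the same way; cutting
  \<open>w\<close> along q then keeps it triangular along r.\<close>

lemma block_diagonal_compat:
  fixes w q q' r r' :: "'c::{ring, monoid_mult}"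
  assumes q: "q' * w * q = w * q" and r: "r' * w * r = w * r"
    and le: "(r * q = q \<and> q * r = q \<and> r' * q' = q' \<and> q' * r' = q') \<or>
      (r * q = r \<and> q * r = r \<and> r' * q' = r' \<and> q' * r' = r')"
  shows "r' * (q' * w * q + (1 - q') * w * (1 - q)) * r = (q' * w * q + (1 - q') * w * (1 - q)) * r"
proof -
  have q': "q' * (w * q) = w * q" "q' * (w * (q * x)) = w * (q * x)"
    "r' * (w * r) = w * r" "r' * (w * (r * x)) = w * (r * x)" for x
    using q r by (metis mult.assoc)+
  from le show ?thesis
  proof
    assume le: "r * q = q \<and> q * r = q \<and> r' * q' = q' \<and> q' * r' = q'"
    then have "r' * (q' * x) = q' * x" "q' * (r' * x) = q' * x" "r * (q * x) = q * x" "q * (r * x) = q * x" for x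
      by (metis mult.assoc)+
    moreover from this have "r' * (w * q) = w * q"
      using q'(1) by metis
    ultimately show ?thesis
      using le by (simp add: algebra_simps q')
  next
    assume le: "r * q = r \<and> q * r = r \<and> r' * q' = r' \<and> q' * r' = r'"
    then have "r' * (q' * x) = r' * x" "q' * (r' * x) = r' * x" "r * (q * x) = r * x" "q * (r * x) = r * x" for x
      by (metis mult.assoc)+
    moreover from this have "q' * (w * r) = w * r"
      using q'(3) by metis
    ultimately show ?thesis
      using le by (simp add: algebra_simps q')
  qed
qed

text \<open>An intertwining already achieved for a smaller projection r survives the cut along the
  larger q.\<close>

lemma block_diagonal_intertwines:
  fixes w q q' r r' :: "'c::{ring, monoid_mult}"
  assumes "w * r = r' * w" "r * q = r \<and> q * r = r \<and> r' * q' = r' \<and> q' * r' = r'"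
  shows "(q' * w * q + (1 - q') * w * (1 - q)) * r = r' * (q' * w * q + (1 - q') * w * (1 - q))"
proof -
  have "r' * (q' * x) = r' * x" "q' * (r' * x) = r' * x" "r * (q * x) = r * x" "q * (r * x) = r * x"
    "w * (r * x) = r' * (w * x)" for x
    using assms by (metis mult.assoc)+
  moreover have "r' * (w * q) = r' * w"
    using assms by (metis mult.assoc)
  ultimately show ?thesis
    using assms by (simp add: algebra_simps)
qed

text \<open>The hypotheses make \<open>g\<close> and its inverse \<open>h\<close> block upper
  triangular for the two chains. Diagonal parts of triangular matrices multiply like the matrices,
  so the diagonal part of \<open>h\<close> inverts that of \<open>g\<close>.\<close>

lemma intertwining_unit:
  fixes qs qs' :: "nat \<Rightarrow> 'c::{ring, monoid_mult}"
  assumes le: "\<And>i j. i \<le> j \<Longrightarrow> j < n \<Longrightarrow> qs j * qs i = qs i \<and> qs i * qs j = qs i"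
    and le': "\<And>i j. i \<le> j \<Longrightarrow> j < n \<Longrightarrow> qs' j * qs' i = qs' i \<and> qs' i * qs' j = qs' i"
    and gh: "g * h = 1" "h * g = 1"
    and g: "\<And>i. i < n \<Longrightarrow> qs' i * g * qs i = g * qs i"
    and h: "\<And>i. i < n \<Longrightarrow> qs i * h * qs' i = h * qs' i"
  obtains w where "w \<in> units" "\<And>i. i < n \<Longrightarrow> w * qs i = qs' i * w"
proof -
  \<comment> \<open>The first k projections are intertwined, while triangularity of both w and v is
    kept for all n because later cuts rely on it.\<close>
  have "\<exists>w v. w * v = 1 \<and> v * w = 1 \<and> (\<forall>i<k. w * qs i = qs' i * w) \<and>
      (\<forall>i<n. qs' i * w * qs i = w * qs i) \<and> (\<forall>i<n. qs i * v * qs' i = v * qs' i)" if "k \<le> n" for k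
    using that
  proof (induction k)
    case 0
    then show ?case
      using gh g h by (intro exI[of _ g] exI[of _ h]) simp
  next
    case (Suc k)
    then obtain w v where wv: "w * v = 1" "v * w = 1" "\<And>i. i < k \<Longrightarrow> w * qs i = qs' i * w"
      "\<And>i. i < n \<Longrightarrow> qs' i * w * qs i = w * qs i" "\<And>i. i < n \<Longrightarrow> qs i * v * qs' i = v * qs' i"
      by auto
    have k: "k < n"
      using Suc.prems by simp
    define q q' where "q = qs k" and "q' = qs' k"
    define w1 v1 where "w1 = q' * w * q + (1 - q') * w * (1 - q)" and "v1 = q * v * q' + (1 - q) * v * (1 - q')"
    have idem: "q * q = q" "q' * q' = q'" and kc: "q' * w * q = w * q" "q * v * q' = v * q'"
      using le[of k k] le'[of k k] wv k by (simp_all add: q_def q'_def)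
    have dich: "(r * q = q \<and> q * r = q \<and> r' * q' = q' \<and> q' * r' = q') \<or>
        (r * q = r \<and> q * r = r \<and> r' * q' = r' \<and> q' * r' = r')" if "i < n" "r = qs i" "r' = qs' i" for i r r'
      using le[of i k] le[of k i] le'[of i k] le'[of k i] that k by (cases "i \<le> k") (auto simp: q_def q'_def)
    have "w1 * v1 = 1" "v1 * w1 = 1" "w1 * q = q' * w1"
      using block_diagonal[OF wv(1) idem kc] block_diagonal[OF wv(2) idem(2,1) kc(2,1)]
      by (simp_all add: w1_def v1_def)
    moreover have "w1 * qs i = qs' i * w1" if "i < k" for i
      unfolding w1_def using le[of i k] le'[of i k] that k
      by (intro block_diagonal_intertwines wv(3)) (simp_all add: q_def q'_def)
    moreover have "qs' i * w1 * qs i = w1 * qs i" "qs i * v1 * qs' i = v1 * qs' i" if "i < n" for i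
      unfolding w1_def v1_def using dich[OF that refl refl] wv(4,5)[OF that]
      by (intro block_diagonal_compat kc; blast)+
    ultimately show ?case
      by (intro exI[of _ w1] exI[of _ v1]) (auto simp: less_Suc_eq q_def q'_def)
  qed
  from this[of n] show ?thesis
    using that unitsI by blast
qed

section \<open>Self-adjoint chains and polar decomposition\<close>

context hermitian_cia
begin

text \<open>Kaplansky's formula \<open>p p\<^sup>* (1 + (p - p\<^sup>*)\<^sup>* (p - p\<^sup>*))\<^sup>-\<^sup>1\<close>.\<close>

lemma selfadjoint_representative:
  assumes "p * p = p"
  obtains q where "star q = q" "q * q = q" "idem_equiv p q"
proof -
  define s where "s = star p"
  define k where "k = scaleC \<i> (p - s)"
  \<comment> \<open>\<open>k * k\<close> is the product of \<open>star (p - star p)\<close> and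
    \<open>p - star p\<close>; as the square of a self-adjoint element it is positive, so z is a
    unit.\<close>
  define z where "z = 1 + k * k"
  have s: "s * s = s" "star s = p" "star p = s"
    using assms by (simp_all add: s_def star_star flip: star_mult)
  have k: "star k = k"
    by (simp add: k_def star_simps s scaleC.scale_right_diff_distrib)
  then have u: "z \<in> units"
    using positive_square[of k] unfolding positive_def z_def by (metis scaleR_one zero_le_one)
  have z: "z = 1 - p - s + p * s + s * p"
    by (simp add: z_def k_def scaleC_mult_scaleC algebra_simps assms s)
  have ass: "p * (p * x) = p * x" "s * (s * x) = s * x" for x
    using assms s by (metis mult.assoc)+
  \<comment> \<open>Consequently p and its adjoint commute with z and with the inverse of z.\<close>
  have pz: "p * z = p * s * p" "z * p = p * s * p" "s * z = s * p * s" "z * s = s * p * s"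
    by (simp_all add: z algebra_simps assms s ass)
  define i where "i = unit_inv z"
  have i: "z * i = 1" "i * z = 1" "i * p = p * i" "i * s = s * i" "star i = i"
    using units_inv[OF u] unit_inv_commute[OF u, of p] unit_inv_commute[OF u, of s] pz star_unit_inv(2)[OF u] k
    by (simp_all add: i_def z_def star_simps)
  have psp: "p * s * p * i = p"
    using pz(1) i(1) by (metis mult.assoc mult_1_right)
  define q where "q = p * s * i"
  have sq: "star q = q"
    using i by (simp add: q_def star_simps s) (metis mult.assoc)
  have pq: "p * q = q"
    by (simp add: q_def ass mult.assoc)
  have qp: "q * p = p"
    using psp i(3) by (simp add: q_def) (metis mult.assoc)
  have "q * q = q * p * (s * i)"
    by (simp add: q_def mult.assoc)
  then have "q * q = q"
    by (simp add: qp) (simp add: q_def mult.assoc)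
  with sq pq qp that show ?thesis
    by (simp add: idem_equiv_def)
qed

text \<open>The representatives can be chosen independently: equality of right ideals gives q j q i
  = q i, and taking adjoints gives q i q j = q i.\<close>

lemma selfadjoint_chain:
  assumes ps: "ps \<in> idem_chains n"
  obtains q where "\<And>i. i < n \<Longrightarrow> star (q i) = q i" "\<And>i. i < n \<Longrightarrow> idem_equiv (ps ! i) (q i)"
    "\<And>i j. i \<le> j \<Longrightarrow> j < n \<Longrightarrow> q j * q i = q i \<and> q i * q j = q i"
proof -
  have "\<exists>q. star q = q \<and> idem_equiv (ps ! i) q" if "i < n" for i
  proof -
    have "ps ! i * ps ! i = ps ! i"
      using ps that by (rule idem_chain_idempotent)
    then show ?thesis
      using selfadjoint_representative by metis
  qed
  then obtain q where q: "\<And>i. i < n \<Longrightarrow> star (q i) = q i" "\<And>i. i < n \<Longrightarrow> idem_equiv (ps ! i) (q i)"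
    by metis
  have "q j * q i = q i \<and> q i * q j = q i" if "i \<le> j" "j < n" for i j
  proof -
    have eq: "ps ! j * (ps ! i * q i) = q i"
      using idem_chain_nth_le[OF ps that] q(2)[of i] that unfolding idem_equiv_def
      by (metis mult.assoc le_less_trans)
    have "q j * (ps ! j * (ps ! i * q i)) = ps ! j * (ps ! i * q i)"
      using q(2)[of j] that by (simp add: idem_equiv_def flip: mult.assoc)
    then have 1: "q j * q i = q i"
      unfolding eq .
    then have "star (q i) * star (q j) = star (q i)"
      by (metis star_mult)
    with 1 show ?thesis
      using q(1) that by simp
  qed
  with q that show ?thesis
    by blast
qed

text \<open>Since \<open>star w * w\<close> commutes with every q i, so does its inverse square
  root; the unitary part of \<open>w\<close> therefore intertwines as \<open>w\<close> does.\<close>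

lemma unitary_of_intertwining_unit:
  assumes "w \<in> units" "\<And>i. i < n \<Longrightarrow> w * q i = q' i * w"
    "\<And>i. i < n \<Longrightarrow> star (q i) = q i" "\<And>i. i < n \<Longrightarrow> star (q' i) = q' i"
  obtains u where "u \<in> unitary_group star" "\<And>i. i < n \<Longrightarrow> u * q i = q' i * (u :: 'a)"
proof -
  have "star (star w * w) = star w * w"
    by (simp add: star_simps)
  then obtain T where T: "star T = T" "T \<in> units" "T * (star w * w) * T = 1"
    "\<And>x. (star w * w) * x = x * (star w * w) \<Longrightarrow> T * x = x * T"
    using hermitian_inverse_square_root unit_segment_star_mult[OF assms(1)] by metis
  show ?thesis
  proof
    show "w * T \<in> unitary_group star"
      using units_mult(1)[OF assms(1) T(2)] T(3)
      by (simp add: unitary_group_def star_simps T(1) mult.assoc)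
    show "w * T * q i = q' i * (w * T)" if "i < n" for i
    proof -
      have "q i * star w = star w * q' i"
        using assms(2-4)[OF that] by (metis star_mult)
      then have "(star w * w) * q i = q i * (star w * w)"
        using assms(2)[OF that] by (metis mult.assoc)
      then have "T * q i = q i * T"
        by (rule T(4))
      then show ?thesis
        using assms(2)[OF that] by (metis mult.assoc)
    qed
  qed
qed

theorem unitary_group_transitive:
  assumes "X \<in> flags n"
  shows "acts_transitively_on (unitary_group star) flag_act (flag_manifold X)"
  unfolding acts_transitively_on_def
proof (intro ballI)
  fix x y assume "x \<in> flag_manifold X" "y \<in> flag_manifold X"
  then obtain g1 g2 where g12: "g1 \<in> units" "g2 \<in> units" "x = flag_act g1 X" "y = flag_act g2 X"
    by (auto simp: flag_manifold_def)
  obtain ps where ps: "ps \<in> idem_chains n" "X = flag_rel n `` {ps}"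
    using assms by (rule flagsE)
  define xs ys where "xs = map (\<lambda>p. g1 * p * unit_inv g1) ps" and "ys = map (\<lambda>p. g2 * p * unit_inv g2) ps"
  have xs: "xs \<in> idem_chains n" "x = flag_rel n `` {xs}" and ys: "ys \<in> idem_chains n" "y = flag_rel n `` {ys}"
    using flag_act_class[OF g12(1) ps(1)] flag_act_class[OF g12(2) ps(1)]
    by (simp_all only: xs_def ys_def g12 ps(2))
  have len: "length xs = n" "length ys = n"
    using xs ys by (auto simp: idem_chains_def)
  \<comment> \<open>g carries the flag x to the flag y.\<close>
  define g h where "g = g2 * unit_inv g1" and "h = g1 * unit_inv g2"
  have gh: "g * h = 1" "h * g = 1"
    unfolding g_def h_def using units_inv[OF g12(1)] units_inv[OF g12(2)] by (metis mult.assoc mult_1_right)+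
  have gx: "g * xs ! i = ys ! i * g" and hy: "h * ys ! i = xs ! i * h" if "i < n" for i
    using len that units_inv(2)[OF g12(1)] units_inv(2)[OF g12(2)]
    by (simp_all add: xs_def ys_def g_def h_def) (metis mult.assoc mult_1_right)+
  obtain q where q: "\<And>i. i < n \<Longrightarrow> star (q i) = q i" "\<And>i. i < n \<Longrightarrow> idem_equiv (xs ! i) (q i)"
    "\<And>i j. i \<le> j \<Longrightarrow> j < n \<Longrightarrow> q j * q i = q i \<and> q i * q j = q i"
    using selfadjoint_chain[OF xs(1)] by metis
  obtain q' where q': "\<And>i. i < n \<Longrightarrow> star (q' i) = q' i" "\<And>i. i < n \<Longrightarrow> idem_equiv (ys ! i) (q' i)"
    "\<And>i j. i \<le> j \<Longrightarrow> j < n \<Longrightarrow> q' j * q' i = q' i \<and> q' i * q' j = q' i"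
    using selfadjoint_chain[OF ys(1)] by metis
  \<comment> \<open>g maps the right ideal of \<open>xs ! i\<close>, which is that of q i, to the
    right ideal of \<open>ys ! i\<close>, which is that of q' i.\<close>
  have compat: "q' i * g * q i = g * q i" "q i * h * q' i = h * q' i" if "i < n" for i
    using gx[OF that] hy[OF that] q(2)[OF that] q'(2)[OF that] unfolding idem_equiv_def
    by (metis mult.assoc)+
  obtain w where w: "w \<in> units" "\<And>i. i < n \<Longrightarrow> w * q i = q' i * w"
    by (rule intertwining_unit[of n q q' g h]) (use q(3) q'(3) gh compat in blast)+
  obtain u where u: "u \<in> unitary_group star" "\<And>i. i < n \<Longrightarrow> u * q i = q' i * u"
    by (rule unitary_of_intertwining_unit[of w n q q']) (use w q(1) q'(1) in blast)+
  have uu: "u \<in> units"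
    using u(1) by (simp add: unitary_group_def)
  \<comment> \<open>u conjugates q i into q' i; passing to the equivalent \<open>xs ! i\<close> and
    \<open>ys ! i\<close> leaves an equivalence, which is all that flags see.\<close>
  have "idem_equiv (u * xs ! i * unit_inv u) (ys ! i)" if "i < n" for i
  proof -
    have e: "xs ! i * q i = q i" "q i * xs ! i = xs ! i" "ys ! i * q' i = q' i" "q' i * ys ! i = ys ! i"
      using q(2)[OF that] q'(2)[OF that] by (simp_all add: idem_equiv_def)
    define v where "v = unit_inv u"
    have v: "u * v = 1" "v * u = 1"
      using units_inv[OF uu] by (simp_all add: v_def)
    have q'_eq: "q' i = u * q i * v"
      using u(2)[OF that] v by (metis mult.assoc mult_1_right)
    have "(u * xs ! i * v) * q' i = u * (xs ! i * q i) * v"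
      unfolding q'_eq v_def by (rule conj_mult_conj[OF uu])
    then have 1: "(u * xs ! i * v) * q' i = q' i"
      by (simp add: e q'_eq)
    have "q' i * (u * xs ! i * v) = u * (q i * xs ! i) * v"
      unfolding q'_eq v_def by (rule conj_mult_conj[OF uu])
    then have 2: "q' i * (u * xs ! i * v) = u * xs ! i * v"
      by (simp add: e)
    show ?thesis
      unfolding idem_equiv_def v_def[symmetric] using 1 2 e by (metis mult.assoc)
  qed
  then have "(map (\<lambda>p. u * p * unit_inv u) xs, ys) \<in> flag_rel n"
    using flag_act_class(1)[OF uu xs(1)] ys(1) len by (simp add: flag_rel_def list_all2_conv_all_nth)
  then have "flag_act u x = y"
    unfolding xs(2) ys(2) flag_act_class(2)[OF uu xs(1)] by (rule flag_class_eqI)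
  then show "\<exists>g\<in>unitary_group star. flag_act g x = y"
    using u(1) by blast
qed

end

section \<open>Hermiticity from unitary transitivity\<close>

text \<open>The line spanned by \<open>(1, a)\<close> is the image of the first coordinate line under a unitary, whose
  first column is then \<open>(1, a) c\<close> with \<open>c\<close> invertible and \<open>c\<^sup>* (1 + a\<^sup>2) c = 1\<close>.\<close>

lemma one_plus_square_in_units_of_transitive:
  fixes star :: "'a::{ring, monoid_mult} \<Rightarrow> 'a"
  assumes trans: "\<And>X :: 'a mat2 list set. X \<in> flags 1 \<Longrightarrow>
      acts_transitively_on (unitary_group (mat2_star star)) flag_act (flag_manifold X)"
    and star: "\<And>x y. star (x * y) = star y * star x" "\<And>x. star (star x) = x"
    and a: "star a = a"
  shows "1 + a * a \<in> units"
proof -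
  have star_one: "star 1 = 1"
    by (metis mult_1_right star)
  define e where "e = Mat2 1 0 0 (0 :: 'a)"
  \<comment> \<open>Maps the first basis vector to (1, a).\<close>
  define g where "g = Mat2 1 0 a 1"
  have "g * Mat2 1 0 (- a) 1 = 1" "Mat2 1 0 (- a) 1 * g = 1"
    by (simp_all add: g_def mat2_defs)
  then have g: "g \<in> units"
    by (rule unitsI)
  have e: "[e] \<in> idem_chains 1"
    by (simp add: idem_chains_def idempotents_def e_def mat2_defs)
  let ?X = "flag_rel 1 `` {[e]}"
  have X: "?X \<in> flags 1"
    using e by (auto simp: flags_def quotient_def)
  have "flag_act 1 ?X \<in> flag_manifold ?X" and gX: "flag_act g ?X \<in> flag_manifold ?X"
    using g one_in_units by (auto simp: flag_manifold_def)
  moreover have "flag_act 1 ?X = ?X"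
    by (simp add: flag_act_def unit_inv_one)
  ultimately have "?X \<in> flag_manifold ?X"
    by simp
  with gX obtain u where u: "u \<in> unitary_group (mat2_star star)" "flag_act u ?X = flag_act g ?X"
    using trans[OF X] unfolding acts_transitively_on_def by blast
  have uu: "u \<in> units" and u1: "mat2_star star u * u = 1"
    using u(1) by (simp_all add: unitary_group_def)
  have "flag_rel 1 `` {[u * e * unit_inv u]} = flag_rel 1 `` {[g * e * unit_inv g]}"
    using u(2) flag_act_class(2)[OF uu e] flag_act_class(2)[OF g e] by simp
  then have "([u * e * unit_inv u], [g * e * unit_inv g]) \<in> flag_rel 1"
    using eq_equiv_class[OF _ equiv_flag_rel] flag_act_class(1)[OF g e] by simp
  then have eq: "(u * e * unit_inv u) * (g * e * unit_inv g) = g * e * unit_inv g"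
    "(g * e * unit_inv g) * (u * e * unit_inv u) = u * e * unit_inv u"
    by (simp_all add: flag_rel_def idem_equiv_def)
  \<comment> \<open>m and its inverse n stabilise the first coordinate line, so both are upper
    triangular and their first entries are mutually inverse. Without the vanishing corner of n, only
    a left inverse of c would result.\<close>
  define m n where "m = unit_inv g * u" and "n = unit_inv u * g"
  have mn: "m * n = 1" "n * m = 1"
    unfolding m_def n_def using units_inv[OF g] units_inv[OF uu] by (metis mult.assoc mult_1_right)+
  have mn': "x \<in> units \<Longrightarrow> unit_inv x * (x * y) = y" for x y :: "'a mat2"
    using units_inv(2) by (metis mult.assoc mult_1_left)
  have "e * n * e = n * e"
    using arg_cong[OF eq(1), of "\<lambda>x. unit_inv u * x * g"] units_inv[OF g]
    by (simp add: n_def mult.assoc mn' uu)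
  then have n21: "ent21 n = 0"
    by (cases n) (simp add: e_def mat2_defs)
  have "e * m * e = m * e"
    using arg_cong[OF eq(2), of "\<lambda>x. unit_inv g * x * u"] units_inv[OF uu]
    by (simp add: m_def mult.assoc mn' g)
  then have m21: "ent21 m = 0"
    by (cases m) (simp add: e_def mat2_defs)
  define c where "c = ent11 m"
  have "ent11 (m * n) = 1" "ent11 (n * m) = 1"
    by (simp_all only: mn) (simp_all add: one_mat2_def)
  then have c: "c * ent11 n = 1" "ent11 n * c = 1"
    by (simp_all add: times_mat2_def n21 m21 c_def)
  have "u = g * m"
    using units_inv(1)[OF g] unfolding m_def by (metis mult.assoc mult_1_left)
  then have "ent11 u = c" "ent21 u = a * c"
    by (simp_all add: g_def times_mat2_def m21 c_def)
  moreover have "ent11 (mat2_star star u * u) = 1"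
    by (simp only: u1) (simp add: one_mat2_def)
  ultimately have "star c * c + star (a * c) * (a * c) = 1"
    by (simp add: times_mat2_def mat2_star_def)
  then have "star c * ((1 + a * a) * c) = 1"
    by (simp add: star a algebra_simps)
  moreover have "star c \<in> units" "c \<in> units"
    using c unitsI[OF c] unitsI[of "star c" "star (ent11 n)"] by (simp_all add: star_one flip: star(1))
  ultimately show ?thesis
    using units_cancel_left units_cancel_right one_in_units by metis
qed

lemma (in continuous_inverse_algebra) hermitian_of_transitive:
  assumes inv: "algebra_involution scaleC star"
    and trans: "\<And>X :: 'a mat2 list set. X \<in> flags 1 \<Longrightarrow>
      acts_transitively_on (unitary_group (mat2_star star)) flag_act (flag_manifold X)"
  shows "hermitian scaleC star"
  unfolding hermitian_def
proof (intro allI impI subsetI)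
  have star: "star (x + y) = star x + star y" "star (scaleC c x) = scaleC (cnj c) (star x)"
    "star (x * y) = star y * star x" "star (star x) = x" for x y c
    using inv by (auto simp: algebra_involution_def)
  have star_one: "star 1 = 1"
    by (metis mult_1_right star(3,4))
  fix a z assume a: "a = star a" and z: "z \<in> spectrum scaleC a"
  show "z \<in> \<real>"
  proof (rule ccontr)
    assume "z \<notin> \<real>"
    then have y: "Im z \<noteq> 0"
      using complex_is_Real_iff by blast
    \<comment> \<open>b = (a - Re z) / Im z, so that z - a = Im z (i - b), while 1 + b^2 = (i - b)
      (-i - b).\<close>
    define b where "b = scaleC (of_real (- Re z / Im z)) 1 + scaleC (of_real (1 / Im z)) a"
    have "star b = b"
      unfolding b_def star(1,2) star_one a[symmetric] by simp
    then have "1 + b * b \<in> units"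
      using one_plus_square_in_units_of_transitive[OF trans star(3,4)] by blast
    moreover have "(scaleC \<i> 1 - b) * (scaleC (- \<i>) 1 - b) = 1 + b * b"
      "(scaleC (- \<i>) 1 - b) * (scaleC \<i> 1 - b) = 1 + b * b"
      by (simp_all add: algebra_simps mult_scaleC_left mult_scaleC_right)
    ultimately have "scaleC \<i> 1 - b \<in> units"
      by (metis units_of_both_products)
    then have "scaleC (of_real (Im z)) (scaleC \<i> 1 - b) \<in> units"
      using y units_scaleC_iff by simp
    also have "scaleC (of_real (Im z)) (scaleC \<i> 1 - b) =
        scaleC (of_real (Im z) * \<i> + of_real (Re z)) 1 - a"
      using y by (simp add: b_def scaleC.scale_right_diff_distrib scaleC.scale_right_distrib
          scaleC.scale_left_distrib)
    also have "of_real (Im z) * \<i> + of_real (Re z) = z"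
      by (simp add: complex_eq_iff)
    finally show False
      using z by (simp add: spectrum_def)
  qed
qed

theorem corollary4p7:
  fixes scaleC :: "complex \<Rightarrow> 'a \<Rightarrow>
      'a::{real_algebra, monoid_mult, t2_space, topological_ab_group_add, topological_semigroup_mult}"
    and star :: "'a \<Rightarrow> 'a"
  assumes "continuous_inverse_algebra scaleC"
    and "mackey_complete TYPE('a)"
    and "algebra_involution scaleC star"
    and "continuous_on UNIV star"
  shows "hermitian scaleC star \<longleftrightarrow>
    (\<forall>n\<ge>1. \<forall>X \<in> (flags n :: 'a mat2 list set set).
      acts_transitively_on (unitary_group (mat2_star star)) flag_act (flag_manifold X))"
proof
  interpret continuous_inverse_algebra scaleC
    by fact
  assume "hermitian scaleC star"
  with assms interpret hermitian_cia scaleC star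
    by unfold_locales
  interpret M: hermitian_cia "mat2_scaleC scaleC" "mat2_star star"
    by (rule mat2_hermitian_cia)
  show "\<forall>n\<ge>1. \<forall>X \<in> (flags n :: 'a mat2 list set set).
      acts_transitively_on (unitary_group (mat2_star star)) flag_act (flag_manifold X)"
    using M.unitary_group_transitive by blast
next
  assume "\<forall>n\<ge>1. \<forall>X \<in> (flags n :: 'a mat2 list set set).
      acts_transitively_on (unitary_group (mat2_star star)) flag_act (flag_manifold X)"
  from this[rule_format, OF order_refl] show "hermitian scaleC star"
    by (rule continuous_inverse_algebra.hermitian_of_transitive[OF assms(1,3)])
qed

end
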